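(* Let $0<\tau<\frac{1+\sqrt5}{2}$ and $\beta>\bar\beta$, where $$\bar\beta=\max\left\{\max\{1/\tau,\tau\}\cdot\lambda_{\max},\ -\frac{\lambda_{\min}}{2}+\frac12\sqrt{\lambda_{\min}^2+\max\left\{\frac1\tau,\frac{\tau^2}{1+\tau-\tau^2}\right\}\cdot8\lambda_{\max}^2}\right\}.$$ Let $\{(L^k,S^k,Z^k,\Lambda^k)\}_{k=1}^\infty$ be a sequence generated by the ADMM described in the context. Suppose that (a1) $\mathcal{B}^*\mathcal{B}\succeq\sigma\mathcal{I}$ for some $\sigma>0$ and $\mathcal{C}^*\mathcal{C}\succeq\sigma'\mathcal{I}$ for some $\sigma'>0$; (a2) $\Psi$ is continuous in its domain; (a3) the first iterate satisfies $\Theta_{\tau,\beta}(L^1,S^1,Z^1,\Lambda^1)<h_0:=\liminf_{\|L\|_F+\|S\|_F\to\infty}\Psi(L)+\Phi(S)$; and suppose in addition that the potential function $\Theta_{\tau,\beta}$ is a KL function. Then the whole sequence $\{(L^k,S^k,Z^k,\Lambda^k)\}_{k=1}^\infty$ converges, and its limit $(L^*,S^*,Z^*,\Lambda^* )$ is such that $(L^*,S^* )$ is a stationary point of the problem $\min_{L,S}\Psi(L)+\Phi(S)+\frac12\|D-\mathcal{A}[\mathcal{B}(L)+\mathcal{C}(S)]\|_F^2$.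
   Context: Setting. $\mathbb{R}^{m\times n}$ carries the trace inner product $\langle X,Y\rangle=\sum_{i,j}x_{ij}y_{ij}$ and Frobenius norm $\|\cdot\|_F$. $D\in\mathbb{R}^{m\times n}$ is given. $\Psi,\Phi:\mathbb{R}^{m\times n}\to\mathbb{R}_+\cup\{\infty\}$ are proper closed (lower semicontinuous) nonnegative functions, $\Psi$ is convex, $\Phi$ is possibly nonconvex and nonsmooth. "Continuous in its domain" means that the restriction of $\Psi$ to $\operatorname{dom}\Psi=\{L:\Psi(L)<\infty\}$ is continuous. $\mathcal{A},\mathcal{B},\mathcal{C}:\mathbb{R}^{m\times n}\to\mathbb{R}^{m\times n}$ are linear maps with $\mathcal{B},\mathcal{C}$ injective; $^*$ denotes the adjoint, $\mathcal{I}$ the identity map. $\lambda_{\max}$ and $\lambda_{\min}$ are the largest and smallest eigenvalues of $\mathcal{A}^*\mathcal{A}$. The problem is $\min_{L,S}\Psi(L)+\Phi(S)+\frac12\|D-\mathcal{A}[\mathcal{B}(L)+\mathcal{C}(S)]\|_F^2$. Its augmented Lagrangian (after introducing $Z=\mathcal{B}(L)+\mathcal{C}(S)$), with penalty parameter $\beta>0$, is $$\mathcal{L}_\beta(L,S,Z,\Lambda)=\Psi(L)+\Phi(S)+\tfrac12\|D-\mathcal{A}(Z)\|_F^2-\langle\Lambda,\mathcal{B}(L)+\mathcal{C}(S)-Z\rangle+\tfrac\beta2\|\mathcal{B}(L)+\mathcal{C}(S)-Z\|_F^2 .$$ ADMM. Given an initial point $(S^0,Z^0,\Lambda^0)$,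 dual step-size $\tau>0$ and $\beta>0$, for $k=0,1,2,\dots$ a sequence generated by the ADMM satisfies $L^{k+1}\in\operatorname{Argmin}_L\mathcal{L}_\beta(L,S^k,Z^k,\Lambda^k)$; $S^{k+1}\in\operatorname{Argmin}_S\mathcal{L}_\beta(L^{k+1},S,Z^k,\Lambda^k)$; $Z^{k+1}=\operatorname{argmin}_Z\mathcal{L}_\beta(L^{k+1},S^{k+1},Z,\Lambda^k)$; $\Lambda^{k+1}=\Lambda^k-\tau\beta(\mathcal{B}(L^{k+1})+\mathcal{C}(S^{k+1})-Z^{k+1})$. Potential function. For $0<\tau<\frac{1+\sqrt5}{2}$, let $\theta(\tau)=\max\left\{1-\tau,\frac{(\tau-1)\tau^2}{1+\tau-\tau^2}\right\}$ and $$\Theta_{\tau,\beta}(L,S,Z,\Lambda)=\mathcal{L}_\beta(L,S,Z,\Lambda)+\theta(\tau)\beta\|\mathcal{B}(L)+\mathcal{C}(S)-Z\|_F^2 .$$ Subdifferential. For a proper function $f$ (on $\mathbb{R}^{m\times n}$ or a product of such spaces, with the Euclidean structure) and $X\in\operatorname{dom}f$, the Fréchet subdifferential $\widehat\partial f(X)$ is the set of $G$ with $\liminf_{Y\ne X,\,Y\to X}\frac{f(Y)-f(X)-\langle G,Y-X\rangle}{\|Y-X\|_F}\ge0$, and the (limiting) subdifferential $\partial f(X)$ is the set of $G$ for which there exist $X^k\to X$ with $f(X^k)\to f(X)$ and $G^k\to G$ with $G^k\in\widehat\partial f(X^k)$ for all $k$. (For convex $f$ it is the usual convex subdifferential.)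 Write $\operatorname{dom}\partial f=\{X:\partial f(X)\ne\emptyset\}$ and $\operatorname{dist}(X,\Omega)=\inf_{Y\in\Omega}\|X-Y\|_F$ (so the distance to the empty set is $+\infty$). KL function. For $\eta>0$, $\Xi_\eta$ is the class of concave functions $\varphi:[0,\eta)\to\mathbb{R}_+$ with $\varphi(0)=0$, $\varphi$ continuously differentiable on $(0,\eta)$ and continuous at $0$, and $\varphi'(x)>0$ for all $x\in(0,\eta)$. A proper lower semicontinuous function $f$ has the Kurdyka-Łojasiewicz (KL) property at $\tilde X\in\operatorname{dom}\partial f$ if there exist $\eta\in(0,+\infty]$, a neighborhood $V$ of $\tilde X$ and $\varphi\in\Xi_\eta$ such that $\varphi'(f(X)-f(\tilde X))\operatorname{dist}(0,\partial f(X))\ge1$ for all $X\in V$ with $f(\tilde X)<f(X)<f(\tilde X)+\eta$. $f$ is a KL function if it has the KL property at each point of $\operatorname{dom}\partial f$. Stationary point. $(L^*,S^* )$ is a stationary point of the problem if $0\in\partial\Psi(L^* )+\mathcal{B}^*\mathcal{A}^*(\mathcal{A}(\mathcal{B}(L^* )+\mathcal{C}(S^* ))-D)$ and $0\in\partial\Phi(S^* )+\mathcal{C}^*\mathcal{A}^*(\mathcal{A}(\mathcal{B}(L^* )+\mathcal{C}(S^* ))-D)$. *)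

theory Defs
  imports "HOL-Analysis.Analysis"
begin

definition edom :: "('a \<Rightarrow> ereal) \<Rightarrow> 'a set" where
  "edom f = {x. f x < \<infinity>}"

definition proper :: "('a \<Rightarrow> ereal) \<Rightarrow> bool" where
  "proper f \<longleftrightarrow> (\<forall>x. f x \<noteq> -\<infinity>) \<and> edom f \<noteq> {}"

definition lsc :: "('a::topological_space \<Rightarrow> ereal) \<Rightarrow> bool" where
  "lsc f \<longleftrightarrow> (\<forall>x. f x \<le> Liminf (at x) f)"

text \<open>Only meant for functions that never take the value \<open>-\<infinity>\<close>. The cases \<open>t = 0\<close>, \<open>t = 1\<close>
  are harmless because \<open>0 * \<infinity> = 0\<close> in \<^typ>\<open>ereal\<close>.\<close>

definition econvex :: "('a::real_vector \<Rightarrow> ereal) \<Rightarrow> bool" where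
  "econvex f \<longleftrightarrow> (\<forall>x y. \<forall>t\<in>{0..1::real}.
     f ((1 - t) *\<^sub>R x + t *\<^sub>R y) \<le> ereal (1 - t) * f x + ereal t * f y)"

text \<open>Both subdifferentials are empty outside the domain of the function.\<close>

definition frechet_subdiff :: "('a::euclidean_space \<Rightarrow> ereal) \<Rightarrow> 'a \<Rightarrow> 'a set" where
  "frechet_subdiff f x = {g. x \<in> edom f \<and>
     0 \<le> Liminf (at x) (\<lambda>y. (f y - f x - ereal (g \<bullet> (y - x))) / ereal (norm (y - x)))}"

definition subdiff :: "('a::euclidean_space \<Rightarrow> ereal) \<Rightarrow> 'a \<Rightarrow> 'a set" where
  "subdiff f x = {g. x \<in> edom f \<and>
     (\<exists>xs gs. xs \<longlonglongrightarrow> x \<and> (\<lambda>k. f (xs k)) \<longlonglongrightarrow> f x \<and> gs \<longlonglongrightarrow> g \<and>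
        (\<forall>k::nat. gs k \<in> frechet_subdiff f (xs k)))}"

definition dom_subdiff :: "('a::euclidean_space \<Rightarrow> ereal) \<Rightarrow> 'a set" where
  "dom_subdiff f = {x. subdiff f x \<noteq> {}}"

text \<open>Unlike \<^const>\<open>infdist\<close>, this is \<open>\<infinity>\<close> for the empty set.\<close>

definition edist :: "'a::metric_space \<Rightarrow> 'a set \<Rightarrow> ereal" where
  "edist x A = (INF y\<in>A. ereal (dist x y))"

definition desingularizing :: "ereal \<Rightarrow> (real \<Rightarrow> real) \<Rightarrow> bool" where
  "desingularizing \<eta> \<phi> \<longleftrightarrow>
     concave_on {x. 0 \<le> x \<and> ereal x < \<eta>} \<phi> \<and>
     (\<forall>x. 0 \<le> x \<and> ereal x < \<eta> \<longrightarrow> 0 \<le> \<phi> x) \<and>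
     \<phi> 0 = 0 \<and>
     (\<forall>x. 0 < x \<and> ereal x < \<eta> \<longrightarrow> \<phi> differentiable at x) \<and>
     continuous_on {x. 0 < x \<and> ereal x < \<eta>} (deriv \<phi>) \<and>
     continuous (at 0 within {x. 0 \<le> x \<and> ereal x < \<eta>}) \<phi> \<and>
     (\<forall>x. 0 < x \<and> ereal x < \<eta> \<longrightarrow> 0 < deriv \<phi> x)"

definition KL_property :: "('a::euclidean_space \<Rightarrow> ereal) \<Rightarrow> 'a \<Rightarrow> bool" where
  "KL_property f x0 \<longleftrightarrow>
     (\<exists>\<eta>::ereal. \<exists>V \<phi>. 0 < \<eta> \<and> x0 \<in> interior V \<and> desingularizing \<eta> \<phi> \<and>
        (\<forall>x\<in>V. f x0 < f x \<and> f x < f x0 + \<eta> \<longrightarrow>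
           1 \<le> ereal (deriv \<phi> (real_of_ereal (f x - f x0))) * edist 0 (subdiff f x)))"

definition KL_function :: "('a::euclidean_space \<Rightarrow> ereal) \<Rightarrow> bool" where
  "KL_function f \<longleftrightarrow> (\<forall>x\<in>dom_subdiff f. KL_property f x)"

definition eigenvalues :: "('a::real_vector \<Rightarrow> 'a) \<Rightarrow> real set" where
  "eigenvalues T = {c. \<exists>v. v \<noteq> 0 \<and> T v = c *\<^sub>R v}"

definition lambda_max :: "('a::euclidean_space \<Rightarrow> 'a) \<Rightarrow> real" where
  "lambda_max A = Max (eigenvalues (adjoint A \<circ> A))"

definition lambda_min :: "('a::euclidean_space \<Rightarrow> 'a) \<Rightarrow> real" where
  "lambda_min A = Min (eigenvalues (adjoint A \<circ> A))"

text \<open>The Loewner order \<open>M \<succeq> N\<close>, for self-adjoint \<open>M\<close> and \<open>N\<close>.\<close>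

definition loewner_ge :: "('a::real_inner \<Rightarrow> 'a) \<Rightarrow> ('a \<Rightarrow> 'a) \<Rightarrow> bool" where
  "loewner_ge M N \<longleftrightarrow> (\<forall>x. 0 \<le> x \<bullet> (M x - N x))"

text \<open>The alternating direction method of multipliers for
  \<open>min \<Psi>(L) + \<Phi>(S) + 1/2 * \<parallel>D - A (B L + C S)\<parallel>\<^sup>2\<close>. For matrices in
  \<^typ>\<open>real^'n^'m\<close>, the library's inner product and norm are the trace inner product and
  the Frobenius norm.\<close>

definition aug_lagrangian ::
  "('a::euclidean_space \<Rightarrow> ereal) \<Rightarrow> ('a \<Rightarrow> ereal) \<Rightarrow> 'a \<Rightarrow> ('a \<Rightarrow> 'a) \<Rightarrow> ('a \<Rightarrow> 'a) \<Rightarrow> ('a \<Rightarrow> 'a) \<Rightarrow>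
   real \<Rightarrow> 'a \<Rightarrow> 'a \<Rightarrow> 'a \<Rightarrow> 'a \<Rightarrow> ereal" where
  "aug_lagrangian \<Psi> \<Phi> D A B C \<beta> L S Z \<Lambda> =
     \<Psi> L + \<Phi> S + ereal (1/2 * (norm (D - A Z))\<^sup>2 - \<Lambda> \<bullet> (B L + C S - Z)
                          + \<beta>/2 * (norm (B L + C S - Z))\<^sup>2)"

text \<open>The initial point is \<open>(S 0, Z 0, \<Lambda> 0)\<close>; the value \<open>L 0\<close> is never used.\<close>

definition ADMM_sequence ::
  "('a::euclidean_space \<Rightarrow> ereal) \<Rightarrow> ('a \<Rightarrow> ereal) \<Rightarrow> 'a \<Rightarrow> ('a \<Rightarrow> 'a) \<Rightarrow> ('a \<Rightarrow> 'a) \<Rightarrow> ('a \<Rightarrow> 'a) \<Rightarrow>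
   real \<Rightarrow> real \<Rightarrow> (nat \<Rightarrow> 'a) \<Rightarrow> (nat \<Rightarrow> 'a) \<Rightarrow> (nat \<Rightarrow> 'a) \<Rightarrow> (nat \<Rightarrow> 'a) \<Rightarrow> bool" where
  "ADMM_sequence \<Psi> \<Phi> D A B C \<tau> \<beta> L S Z \<Lambda> \<longleftrightarrow> (\<forall>k.
     is_arg_min (\<lambda>X. aug_lagrangian \<Psi> \<Phi> D A B C \<beta> X (S k) (Z k) (\<Lambda> k)) (\<lambda>_. True) (L (Suc k)) \<and>
     is_arg_min (\<lambda>X. aug_lagrangian \<Psi> \<Phi> D A B C \<beta> (L (Suc k)) X (Z k) (\<Lambda> k)) (\<lambda>_. True) (S (Suc k)) \<and>
     is_arg_min (\<lambda>X. aug_lagrangian \<Psi> \<Phi> D A B C \<beta> (L (Suc k)) (S (Suc k)) X (\<Lambda> k)) (\<lambda>_. True) (Z (Suc k)) \<and>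
     \<Lambda> (Suc k) = \<Lambda> k - (\<tau> * \<beta>) *\<^sub>R (B (L (Suc k)) + C (S (Suc k)) - Z (Suc k)))"

text \<open>The intended range is \<open>0 < \<tau> < (1 + sqrt 5) / 2\<close>, where \<open>1 + \<tau> - \<tau>\<^sup>2 > 0\<close>.\<close>

definition theta :: "real \<Rightarrow> real" where
  "theta \<tau> = max (1 - \<tau>) ((\<tau> - 1) * \<tau>\<^sup>2 / (1 + \<tau> - \<tau>\<^sup>2))"

definition potential ::
  "('a::euclidean_space \<Rightarrow> ereal) \<Rightarrow> ('a \<Rightarrow> ereal) \<Rightarrow> 'a \<Rightarrow> ('a \<Rightarrow> 'a) \<Rightarrow> ('a \<Rightarrow> 'a) \<Rightarrow> ('a \<Rightarrow> 'a) \<Rightarrow>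
   real \<Rightarrow> real \<Rightarrow> 'a \<Rightarrow> 'a \<Rightarrow> 'a \<Rightarrow> 'a \<Rightarrow> ereal" where
  "potential \<Psi> \<Phi> D A B C \<tau> \<beta> L S Z \<Lambda> =
     aug_lagrangian \<Psi> \<Phi> D A B C \<beta> L S Z \<Lambda> + ereal (theta \<tau> * \<beta> * (norm (B L + C S - Z))\<^sup>2)"

definition beta_bar :: "('a::euclidean_space \<Rightarrow> 'a) \<Rightarrow> real \<Rightarrow> real" where
  "beta_bar A \<tau> = max (max (1 / \<tau>) \<tau> * lambda_max A)
     (- lambda_min A / 2 + 1/2 * sqrt ((lambda_min A)\<^sup>2
        + max (1 / \<tau>) (\<tau>\<^sup>2 / (1 + \<tau> - \<tau>\<^sup>2)) * (8 * (lambda_max A)\<^sup>2)))"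

definition liminf_at_infinity ::
  "('a::real_normed_vector \<Rightarrow> ereal) \<Rightarrow> ('a \<Rightarrow> ereal) \<Rightarrow> ereal" where
  "liminf_at_infinity \<Psi> \<Phi> =
     Liminf (filtercomap (\<lambda>(L, S). norm L + norm S) at_top) (\<lambda>(L, S). \<Psi> L + \<Phi> S)"

definition stationary_point ::
  "('a::euclidean_space \<Rightarrow> ereal) \<Rightarrow> ('a \<Rightarrow> ereal) \<Rightarrow> 'a \<Rightarrow> ('a \<Rightarrow> 'a) \<Rightarrow> ('a \<Rightarrow> 'a) \<Rightarrow> ('a \<Rightarrow> 'a) \<Rightarrow>
   'a \<Rightarrow> 'a \<Rightarrow> bool" where
  "stationary_point \<Psi> \<Phi> D A B C L S \<longleftrightarrow>
     0 \<in> (\<lambda>G. G + adjoint B (adjoint A (A (B L + C S) - D))) ` subdiff \<Psi> L \<and>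
     0 \<in> (\<lambda>G. G + adjoint C (adjoint A (A (B L + C S) - D))) ` subdiff \<Phi> S"

end

theory Submission
  imports Defs
begin

text \<open>Optimality of the \<open>Z\<close>-step makes the multiplier explicit,
  \<open>\<Lambda> = (1 - \<tau>) \<beta> r - \<nabla>f(Z)\<close> with \<open>f(Z) = \<parallel>D - A Z\<parallel>\<^sup>2 / 2\<close> and the residual
  \<open>r = B L + C S - Z\<close>, so that successive residuals obey the recursion
  \<open>r' = (1 - \<tau>) r + A\<^sup>*A (Z' - Z) / \<beta>\<close>. Since \<open>\<bar>1 - \<tau>\<bar> < 1\<close>, the residuals are controlled by the
  increments of \<open>Z\<close>; the choice of \<open>\<theta>(\<tau>)\<close> and \<open>\<beta> > \<beta>-bar\<close> is exactly what makes the potential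
  decrease by a multiple of \<open>\<parallel>L' - L\<parallel>\<^sup>2 + \<parallel>Z' - Z\<parallel>\<^sup>2\<close>. The potential also dominates \<open>\<Psi> + \<Phi>\<close>, so the
  iterates are bounded, and the optimality conditions of the steps give subgradients of the potential
  of size \<open>O(\<parallel>r\<parallel> + \<parallel>L' - L\<parallel> + \<parallel>Z' - Z\<parallel>)\<close>. The KL inequality at one cluster point then traps the
  sequence near it, and passing to the limit in the optimality conditions gives stationarity.\<close>

section \<open>Extreme eigenvalues of the Gram operator\<close>

text \<open>For small \<open>t\<close> of sign opposite to \<open>a\<close> the linear term
  outweighs the quadratic one. This is the first-order condition behind both the Rayleigh quotients
  and the \<open>Z\<close>-step.\<close>

lemma linear_coeff_eq_0:
  fixes a b :: real
  assumes "\<And>t. 0 \<le> 2 * t * a + t\<^sup>2 * b"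
  shows "a = 0"
proof (rule ccontr)
  assume "a \<noteq> 0"
  define c where "c = \<bar>b\<bar> + 1"
  have c: "c > 0" "b < c" by (auto simp: c_def)
  have "0 \<le> 2 * (- a / c) * a + (- a / c)\<^sup>2 * b" by (rule assms)
  also have "\<dots> = (a / c)\<^sup>2 * (b - 2 * c)"
    using c by (simp add: field_simps power2_eq_square)
  also have "\<dots> < 0"
    using c \<open>a \<noteq> 0\<close> by (intro mult_pos_neg) auto
  finally show False by simp
qed

text \<open>Moving from \<open>v\<close> in the direction \<open>T v\<close> changes the form by
  \<open>2 * t * (T v \<bullet> T v)\<close> to first order, and a minimum at value 0 leaves no room
  for such a term. It makes extremal points of Rayleigh quotients eigenvectors.\<close>

lemma psd_form_zero_imp_kernel:
  fixes T :: "'a::real_inner \<Rightarrow> 'a"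
  assumes "linear T" and sym: "\<And>x y. T x \<bullet> y = x \<bullet> T y"
    and psd: "\<And>x. 0 \<le> x \<bullet> T x" and v: "v \<bullet> T v = 0"
  shows "T v = 0"
proof -
  interpret linear T by fact
  have "0 \<le> 2 * t * (T v \<bullet> T v) + t\<^sup>2 * (T v \<bullet> T (T v))" for t
    using psd[of "v + t *\<^sub>R T v"] v sym[of v "T v"]
    by (simp add: add scale inner_simps power2_eq_square algebra_simps inner_commute)
  then have "T v \<bullet> T v = 0" by (rule linear_coeff_eq_0)
  then show ?thesis by simp
qed

text \<open>Eigenvectors of a symmetric operator for distinct eigenvalues are orthogonal, so
  choosing one per eigenvalue gives an independent set. Finiteness makes the \<open>Max\<close> and
  \<open>Min\<close> in \<open>lambda_max\<close> and \<open>lambda_min\<close> genuine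
  bounds.\<close>

lemma finite_eigenvalues:
  fixes T :: "'a::euclidean_space \<Rightarrow> 'a"
  assumes sym: "\<And>x y. T x \<bullet> y = x \<bullet> T y"
  shows "finite (eigenvalues T)"
proof -
  define v where "v c = (SOME u. u \<noteq> 0 \<and> T u = c *\<^sub>R u)" for c
  have v: "v c \<noteq> 0 \<and> T (v c) = c *\<^sub>R v c" if "c \<in> eigenvalues T" for c
    unfolding v_def by (rule someI_ex) (use that in \<open>auto simp: eigenvalues_def\<close>)
  have orth: "v c \<bullet> v d = 0" if "c \<in> eigenvalues T" "d \<in> eigenvalues T" "c \<noteq> d" for c d
    using sym[of "v c" "v d"] v[OF that(1)] v[OF that(2)] that(3) by simp
  have inj: "inj_on v (eigenvalues T)"
    by (rule inj_onI) (metis orth v inner_eq_zero_iff)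
  have "pairwise orthogonal (v ` eigenvalues T)"
    using orth by (auto simp: pairwise_def orthogonal_def)
  moreover have "0 \<notin> v ` eigenvalues T" using v by auto
  ultimately have "finite (v ` eigenvalues T)"
    by (intro conjunct1[OF independent_bound_general] pairwise_orthogonal_independent)
  then show ?thesis using inj by (rule finite_imageD)
qed

context
  fixes A :: "'a::euclidean_space \<Rightarrow> 'a"
  assumes lin: "linear A"
begin

lemma gram_sym: "adjoint A (A x) \<bullet> y = x \<bullet> adjoint A (A y)"
  by (simp add: adjoint_clauses[OF lin])

lemma inner_gram: "x \<bullet> adjoint A (A x) = (norm (A x))\<^sup>2"
  by (simp add: adjoint_clauses[OF lin] power2_norm_eq_inner)

lemma linear_gram: "linear (\<lambda>x. adjoint A (A x))"
  using linear_compose[OF lin adjoint_linear[OF lin]] by (simp add: o_def)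

lemma norm_scaled_to_sphere:
  assumes "x \<noteq> 0"
  shows "norm (A x) = norm (A (x /\<^sub>R norm x)) * norm x"
  using assms by (simp add: linear_scale[OF lin])

lemma eigenvalues_gram_finite: "finite (eigenvalues (adjoint A \<circ> A))"
  by (rule finite_eigenvalues) (simp add: gram_sym)

text \<open>Let \<open>v\<close> maximize \<open>norm (A v)\<close> on the unit sphere, with squared
  maximum \<open>\<mu>\<close>. Then \<open>\<mu>\<close> times the identity minus the Gram operator
  is positive semidefinite and its form vanishes at \<open>v\<close>, so \<open>v\<close> is an
  eigenvector for \<open>\<mu>\<close>.\<close>

lemma norm_sq_le_lambda_max: "(norm (A x))\<^sup>2 \<le> lambda_max A * (norm x)\<^sup>2"
proof -
  have "compact (sphere (0::'a) 1)" "sphere (0::'a) 1 \<noteq> {}" by auto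
  moreover have "continuous_on (sphere 0 1) (\<lambda>x. norm (A x))"
    by (intro continuous_intros linear_continuous_on) (use lin in \<open>simp add: linear_conv_bounded_linear\<close>)
  ultimately obtain v where v: "v \<in> sphere 0 1" and max: "\<And>x. x \<in> sphere 0 1 \<Longrightarrow> norm (A x) \<le> norm (A v)"
    using continuous_attains_sup by metis
  define \<mu> where "\<mu> = (norm (A v))\<^sup>2"
  have bound: "(norm (A x))\<^sup>2 \<le> \<mu> * (norm x)\<^sup>2" for x
  proof (cases "x = 0")
    case False
    then have "norm (A (x /\<^sub>R norm x)) \<le> norm (A v)" by (intro max) simp
    then have "norm (A x) \<le> norm (A v) * norm x"
      unfolding norm_scaled_to_sphere[OF False] by (rule mult_right_mono) simp
    then show ?thesis by (simp add: \<mu>_def flip: power_mult_distrib)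
  qed (simp add: linear_0[OF lin])
  have "\<mu> *\<^sub>R v - adjoint A (A v) = 0"
  proof (rule psd_form_zero_imp_kernel[where T = "\<lambda>x. \<mu> *\<^sub>R x - adjoint A (A x)"])
    show "linear (\<lambda>x. \<mu> *\<^sub>R x - adjoint A (A x))"
      by (intro linear_compose_sub linear_gram linear_scale_self)
    show "(\<mu> *\<^sub>R x - adjoint A (A x)) \<bullet> y = x \<bullet> (\<mu> *\<^sub>R y - adjoint A (A y))" for x y
      by (simp add: inner_diff gram_sym)
    show "0 \<le> x \<bullet> (\<mu> *\<^sub>R x - adjoint A (A x))" for x
      using bound[of x] by (simp add: inner_diff inner_gram power2_norm_eq_inner[of x])
    show "v \<bullet> (\<mu> *\<^sub>R v - adjoint A (A v)) = 0"
      using v by (simp add: inner_diff inner_gram \<mu>_def power2_norm_eq_inner[of v, symmetric])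
  qed
  then have "\<mu> \<in> eigenvalues (adjoint A \<circ> A)"
    using v by (auto simp: eigenvalues_def intro!: exI[of _ v])
  then have "\<mu> \<le> lambda_max A"
    unfolding lambda_max_def by (intro Max_ge eigenvalues_gram_finite)
  then show ?thesis
    using bound[of x] mult_right_mono[of \<mu> "lambda_max A" "(norm x)\<^sup>2"] by simp
qed

text \<open>Mirror image of the previous argument, with a minimizer on the sphere and the Gram
  operator minus \<open>\<mu>\<close> times the identity.\<close>

lemma lambda_min_le_norm_sq: "lambda_min A * (norm x)\<^sup>2 \<le> (norm (A x))\<^sup>2"
proof -
  have "compact (sphere (0::'a) 1)" "sphere (0::'a) 1 \<noteq> {}" by auto
  moreover have "continuous_on (sphere 0 1) (\<lambda>x. norm (A x))"
    by (intro continuous_intros linear_continuous_on) (use lin in \<open>simp add: linear_conv_bounded_linear\<close>)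
  ultimately obtain v where v: "v \<in> sphere 0 1" and min: "\<And>x. x \<in> sphere 0 1 \<Longrightarrow> norm (A v) \<le> norm (A x)"
    using continuous_attains_inf by metis
  define \<mu> where "\<mu> = (norm (A v))\<^sup>2"
  have bound: "\<mu> * (norm x)\<^sup>2 \<le> (norm (A x))\<^sup>2" for x
  proof (cases "x = 0")
    case False
    then have "norm (A v) \<le> norm (A (x /\<^sub>R norm x))" by (intro min) simp
    then have "norm (A v) * norm x \<le> norm (A x)"
      unfolding norm_scaled_to_sphere[OF False] by (rule mult_right_mono) simp
    then show ?thesis by (simp add: \<mu>_def power_mono flip: power_mult_distrib)
  qed (simp add: linear_0[OF lin])
  have "adjoint A (A v) - \<mu> *\<^sub>R v = 0"
  proof (rule psd_form_zero_imp_kernel[where T = "\<lambda>x. adjoint A (A x) - \<mu> *\<^sub>R x"])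
    show "linear (\<lambda>x. adjoint A (A x) - \<mu> *\<^sub>R x)"
      by (intro linear_compose_sub linear_gram linear_scale_self)
    show "(adjoint A (A x) - \<mu> *\<^sub>R x) \<bullet> y = x \<bullet> (adjoint A (A y) - \<mu> *\<^sub>R y)" for x y
      by (simp add: inner_diff gram_sym)
    show "0 \<le> x \<bullet> (adjoint A (A x) - \<mu> *\<^sub>R x)" for x
      using bound[of x] by (simp add: inner_diff inner_gram power2_norm_eq_inner[of x])
    show "v \<bullet> (adjoint A (A v) - \<mu> *\<^sub>R v) = 0"
      using v by (simp add: inner_diff inner_gram \<mu>_def power2_norm_eq_inner[of v, symmetric])
  qed
  then have "\<mu> \<in> eigenvalues (adjoint A \<circ> A)"
    using v by (auto simp: eigenvalues_def intro!: exI[of _ v])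
  then have "lambda_min A \<le> \<mu>"
    unfolding lambda_min_def by (intro Min_le eigenvalues_gram_finite)
  then show ?thesis
    using bound[of x] mult_right_mono[of "lambda_min A" \<mu> "(norm x)\<^sup>2"] by simp
qed

lemma lambda_max_nonneg: "0 \<le> lambda_max A"
proof -
  obtain b :: 'a where b: "b \<in> Basis" using nonempty_Basis by blast
  have "0 \<le> (norm (A b))\<^sup>2" by simp
  also have "\<dots> \<le> lambda_max A" using norm_sq_le_lambda_max[of b] b by simp
  finally show ?thesis .
qed

lemma norm_gram_le: "norm (adjoint A (A x)) \<le> lambda_max A * norm x"
proof -
  let ?y = "adjoint A (A x)"
  let ?l = "lambda_max A"
  \<comment> \<open>Fourth powers avoid square roots of \<open>?l\<close>; the common factor
    \<open>(norm ?y)\<^sup>2\<close> is cancelled afterwards.\<close>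
  have "((norm ?y)\<^sup>2)\<^sup>2 = (A x \<bullet> A ?y)\<^sup>2"
    unfolding power2_norm_eq_inner by (simp add: adjoint_clauses[OF lin] inner_commute)
  also have "\<dots> \<le> (norm (A x) * norm (A ?y))\<^sup>2"
    using Cauchy_Schwarz_ineq2[of "A x" "A ?y"] by (simp add: abs_le_square_iff[symmetric])
  also have "\<dots> \<le> (?l * (norm x)\<^sup>2) * (?l * (norm ?y)\<^sup>2)"
    unfolding power_mult_distrib
    by (intro mult_mono norm_sq_le_lambda_max) (auto simp: lambda_max_nonneg)
  also have "\<dots> = (?l * norm x)\<^sup>2 * (norm ?y)\<^sup>2"
    by (simp add: power_mult_distrib power2_eq_square)
  finally have "(norm ?y)\<^sup>2 * (norm ?y)\<^sup>2 \<le> (?l * norm x)\<^sup>2 * (norm ?y)\<^sup>2"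
    by (simp add: power2_eq_square)
  then have "?y = 0 \<or> (norm ?y)\<^sup>2 \<le> (?l * norm x)\<^sup>2"
    by (metis mult_le_cancel_right zero_less_power2 norm_eq_zero)
  then show ?thesis
    by (auto simp: lambda_max_nonneg intro: power2_le_imp_le)
qed

end

section \<open>Frechet subgradients and lower semicontinuity\<close>

lemma frechet_subdiff_subset_subdiff: "frechet_subdiff f x \<subseteq> subdiff f x"
proof
  fix g assume g: "g \<in> frechet_subdiff f x"
  then have "x \<in> edom f" by (simp add: frechet_subdiff_def)
  moreover have "\<exists>xs gs. xs \<longlonglongrightarrow> x \<and> (\<lambda>k. f (xs k)) \<longlonglongrightarrow> f x \<and> gs \<longlonglongrightarrow> g \<and>
      (\<forall>k::nat. gs k \<in> frechet_subdiff f (xs k))"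
    by (rule exI[of _ "\<lambda>_. x"], rule exI[of _ "\<lambda>_. g"]) (use g in simp)
  ultimately show "g \<in> subdiff f x"
    by (simp add: subdiff_def)
qed

text \<open>The filter is \<^const>\<open>nhds\<close> rather than \<^const>\<open>at\<close>, because a projection of \<open>y \<noteq> x\<close> may agree
  with that of \<open>x\<close>.\<close>

definition frechet_minorant :: "('a::real_inner \<Rightarrow> ereal) \<Rightarrow> 'a \<Rightarrow> 'a \<Rightarrow> bool" where
  "frechet_minorant f x g \<longleftrightarrow>
     (\<forall>\<epsilon>>0. \<forall>\<^sub>F y in nhds x. f x + ereal (g \<bullet> (y - x) - \<epsilon> * norm (y - x)) \<le> f y)"

lemma frechet_minorant_imp_subdiff:
  assumes "\<bar>f x\<bar> \<noteq> \<infinity>" and g: "frechet_minorant f x g"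
  shows "g \<in> frechet_subdiff f x"
proof -
  obtain c where c: "f x = ereal c" using assms(1) by auto
  have "\<forall>\<^sub>F y in at x. b < (f y - f x - ereal (g \<bullet> (y - x))) / ereal (norm (y - x))" if b: "b < 0" for b
  proof -
    \<comment> \<open>\<open>b\<close> may be minus infinity, so a real number is inserted between
      \<open>b\<close> and 0.\<close>
    obtain \<epsilon>' where \<epsilon>': "b < ereal \<epsilon>'" "ereal \<epsilon>' < 0" using ereal_dense2[OF b] by blast
    define \<epsilon> where "\<epsilon> = - \<epsilon>'"
    have \<epsilon>: "\<epsilon> > 0" "b < ereal (- \<epsilon>)" using \<epsilon>' by (auto simp: \<epsilon>_def)
    have "\<forall>\<^sub>F y in at x. f x + ereal (g \<bullet> (y - x) - \<epsilon> * norm (y - x)) \<le> f y \<and> y \<noteq> x"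
      using g \<epsilon>(1) unfolding frechet_minorant_def eventually_at_filter
      by (auto elim: eventually_mono)
    then show ?thesis
    proof (rule eventually_mono)
      fix y assume y: "f x + ereal (g \<bullet> (y - x) - \<epsilon> * norm (y - x)) \<le> f y \<and> y \<noteq> x"
      have "ereal (- \<epsilon>) \<le> (f y - f x - ereal (g \<bullet> (y - x))) / ereal (norm (y - x))"
        using y c by (cases "f y") (auto simp: field_simps)
      with \<epsilon>(2) show "b < (f y - f x - ereal (g \<bullet> (y - x))) / ereal (norm (y - x))"
        by (rule less_le_trans)
    qed
  qed
  then show ?thesis
    using c by (auto simp: frechet_subdiff_def edom_def le_Liminf_iff)
qed

lemma has_derivative_inner_remainder:
  fixes q :: "'a::real_inner \<Rightarrow> real"
  assumes "(q has_derivative (\<lambda>h. v \<bullet> h)) (at x)" and "\<epsilon> > 0"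
  shows "\<forall>\<^sub>F y in nhds x. \<bar>q y - q x - v \<bullet> (y - x)\<bar> \<le> \<epsilon> * norm (y - x)"
  using assms unfolding has_derivative_at_alt eventually_nhds_metric dist_norm real_norm_def by blast

text \<open>Fermat's rule with a smooth summand: minimality bounds the decrease of \<open>f\<close>
  by the increase of \<open>q\<close>, whose linearization errs by at most
  \<open>\<epsilon> * norm (y - x)\<close> near \<open>x\<close>.\<close>

lemma minimizer_imp_frechet_minorant:
  fixes f :: "'a::real_inner \<Rightarrow> ereal"
  assumes min: "\<And>y. f x + ereal (q x) \<le> f y + ereal (q y)"
    and q: "(q has_derivative (\<lambda>h. v \<bullet> h)) (at x)"
    and fin: "\<bar>f x\<bar> \<noteq> \<infinity>"
  shows "frechet_minorant f x (- v)"
  unfolding frechet_minorant_def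
proof (intro allI impI)
  fix \<epsilon> :: real assume "\<epsilon> > 0"
  from has_derivative_inner_remainder[OF q this]
  show "\<forall>\<^sub>F y in nhds x. f x + ereal (- v \<bullet> (y - x) - \<epsilon> * norm (y - x)) \<le> f y"
  proof (rule eventually_mono)
    fix y assume "\<bar>q y - q x - v \<bullet> (y - x)\<bar> \<le> \<epsilon> * norm (y - x)"
    then show "f x + ereal (- v \<bullet> (y - x) - \<epsilon> * norm (y - x)) \<le> f y"
      using min[of y] fin by (cases "f x"; cases "f y") auto
  qed
qed

text \<open>Each of the three expansions receives a third of \<open>\<epsilon>\<close>, since the
  norm of a block is at most the norm of the whole increment. In the application the third block is
  the pair of \<open>Z\<close> and \<open>\<Lambda>\<close>.\<close>

lemma frechet_minorant_separable_sum:
  fixes f :: "'a::real_inner \<Rightarrow> ereal" and h :: "'b::real_inner \<Rightarrow> ereal"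
    and q :: "'a \<times> 'b \<times> 'c::real_inner \<Rightarrow> real"
  assumes f: "frechet_minorant f x u" and h: "frechet_minorant h y v"
    and fin: "\<bar>f x\<bar> \<noteq> \<infinity>" "\<bar>h y\<bar> \<noteq> \<infinity>"
    and q: "(q has_derivative (\<lambda>d. g \<bullet> d)) (at (x, y, z))"
  shows "frechet_minorant (\<lambda>(x, y, z). f x + h y + ereal (q (x, y, z))) (x, y, z) ((u, v, 0) + g)"
  unfolding frechet_minorant_def
proof (intro allI impI)
  fix \<epsilon> :: real assume \<epsilon>: "\<epsilon> > 0"
  let ?w = "(x, y, z)"
  have fst_lim: "((\<lambda>w. fst w) \<longlongrightarrow> x) (nhds ?w)" and snd_lim: "((\<lambda>w. fst (snd w)) \<longlongrightarrow> y) (nhds ?w)"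
    using tendsto_ident_at by (auto intro!: tendsto_eq_intros filterlim_ident)
  have 1: "\<forall>\<^sub>F w in nhds ?w. f x + ereal (u \<bullet> (fst w - x) - \<epsilon> / 3 * norm (fst w - x)) \<le> f (fst w)"
    by (rule eventually_compose_filterlim[OF f[unfolded frechet_minorant_def, rule_format] fst_lim])
      (use \<epsilon> in simp)
  have 2: "\<forall>\<^sub>F w in nhds ?w. h y + ereal (v \<bullet> (fst (snd w) - y) - \<epsilon> / 3 * norm (fst (snd w) - y)) \<le> h (fst (snd w))"
    by (rule eventually_compose_filterlim[OF h[unfolded frechet_minorant_def, rule_format] snd_lim])
      (use \<epsilon> in simp)
  have 3: "\<forall>\<^sub>F w in nhds ?w. \<bar>q w - q ?w - g \<bullet> (w - ?w)\<bar> \<le> \<epsilon> / 3 * norm (w - ?w)"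
    using has_derivative_inner_remainder[OF q, of "\<epsilon> / 3"] \<epsilon> by simp
  show "\<forall>\<^sub>F w in nhds ?w. (case ?w of (x, y, z) \<Rightarrow> f x + h y + ereal (q (x, y, z))) +
          ereal (((u, v, 0) + g) \<bullet> (w - ?w) - \<epsilon> * norm (w - ?w))
        \<le> (case w of (x, y, z) \<Rightarrow> f x + h y + ereal (q (x, y, z)))"
    using 1 2 3
  proof eventually_elim
    case (elim w)
    obtain a b c where w: "w = (a, b, c)" by (cases w)
    have "norm (a - x) \<le> norm (w - ?w)"
      using norm_fst_le[of "a - x" "(b - y, c - z)"] by (simp add: w)
    moreover have "norm (b - y) \<le> norm (w - ?w)"
      using norm_snd_le[of "(b - y, c - z)" "a - x"] norm_fst_le[of "b - y" "c - z"] by (simp add: w)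
    ultimately have "\<epsilon> / 3 * norm (a - x) \<le> \<epsilon> / 3 * norm (w - ?w)"
        "\<epsilon> / 3 * norm (b - y) \<le> \<epsilon> / 3 * norm (w - ?w)"
      using \<epsilon> by (auto intro!: mult_left_mono)
    moreover have "((u, v, 0) + g) \<bullet> (w - ?w) = u \<bullet> (a - x) + v \<bullet> (b - y) + g \<bullet> (w - ?w)"
      by (simp add: w inner_add_left)
    moreover have "\<epsilon> * norm (w - ?w) = 3 * (\<epsilon> / 3 * norm (w - ?w))" by simp
    ultimately have "u \<bullet> (a - x) - \<epsilon> / 3 * norm (a - x) + (v \<bullet> (b - y) - \<epsilon> / 3 * norm (b - y)) + (q w - q ?w)
        \<ge> ((u, v, 0) + g) \<bullet> (w - ?w) - \<epsilon> * norm (w - ?w)"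
      using elim(3) by linarith
    then show ?case
      using elim(1,2) fin unfolding w
      by (cases "f x"; cases "h y"; cases "f a"; cases "h b") (auto simp del: inner_Pair)
  qed
qed

lemma lsc_limit_le:
  assumes "lsc f" and xs: "xs \<longlonglongrightarrow> x" and le: "\<forall>\<^sub>F k in sequentially. f (xs k) \<le> c"
  shows "f x \<le> c"
proof (rule ccontr)
  assume "\<not> f x \<le> c"
  then have c: "c < f x" by simp
  also have "\<dots> \<le> Liminf (at x) f" using assms(1) by (simp add: lsc_def)
  finally have "\<forall>\<^sub>F y in at x. c < f y" by (rule less_LiminfD)
  \<comment> \<open>\<open>lsc\<close> speaks about punctured neighbourhoods only;
    \<open>c < f x\<close> adds the centre, which the sequence may hit.\<close>
  then have "\<forall>\<^sub>F y in nhds x. c < f y"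
    using c unfolding eventually_at_filter by (auto elim: eventually_mono)
  then have "\<forall>\<^sub>F k in sequentially. c < f (xs k)"
    using xs by (rule eventually_compose_filterlim)
  with le have "\<forall>\<^sub>F k in sequentially. False"
    by eventually_elim simp
  then show False by simp
qed

text \<open>Lower semicontinuity supplies the lower half of the limit, the comparison with
  \<open>f x\<close> the upper half. Limiting subgradients require such convergence of function
  values.\<close>

lemma lsc_tendsto_of_upper_bound:
  assumes "lsc f" and "xs \<longlonglongrightarrow> x" and le: "\<And>k. f (xs k) \<le> f x + ereal (d k)" and d: "d \<longlonglongrightarrow> 0"
  shows "(\<lambda>k. f (xs k)) \<longlonglongrightarrow> f x"
proof (rule order_tendstoI)
  fix c assume c: "c < f x"
  have "c < f x \<Longrightarrow> f x \<le> Liminf (at x) f" using assms(1) by (simp add: lsc_def)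
  with c have "\<forall>\<^sub>F y in at x. c < f y" by (intro less_LiminfD) auto
  then have "\<forall>\<^sub>F y in nhds x. c < f y"
    using c unfolding eventually_at_filter by (auto elim: eventually_mono)
  then show "\<forall>\<^sub>F k in sequentially. c < f (xs k)"
    using assms(2) by (rule eventually_compose_filterlim)
next
  fix c assume c: "f x < c"
  have "(\<lambda>k. f x + ereal (d k)) \<longlonglongrightarrow> f x + ereal 0"
    using d by (intro tendsto_add_ereal_general) auto
  then have "\<forall>\<^sub>F k in sequentially. f x + ereal (d k) < c"
    using c by (intro order_tendstoD) auto
  then show "\<forall>\<^sub>F k in sequentially. f (xs k) < c"
    by eventually_elim (rule le_less_trans[OF le])
qed

section \<open>Convergence of descent sequences under the KL inequality\<close>

lemma desingularizing_concave_step: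
  assumes "desingularizing \<eta> \<phi>" and s: "0 < s" "ereal s < \<eta>" and t: "0 \<le> t" "t \<le> s"
  shows "deriv \<phi> s * (s - t) \<le> \<phi> s - \<phi> t"
proof -
  let ?I = "{x. 0 \<le> x \<and> ereal x < \<eta>}"
  \<comment> \<open>The tangent inequality wants \<open>s\<close> in the interior of an interval; a
    real \<open>r\<close> above \<open>s\<close> provides one even for infinite
    \<open>\<eta>\<close>, while \<open>t\<close> may be the end point 0.\<close>
  obtain r where r: "ereal s < ereal r" "ereal r < \<eta>" using ereal_dense2[OF s(2)] by blast
  have sub: "{0..r} \<subseteq> ?I" by (auto intro!: le_less_trans[OF _ r(2)])
  have "convex_on ?I (\<lambda>x. - \<phi> x)"
    using assms(1) by (simp add: desingularizing_def concave_on_def)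
  then have "convex_on {0..r} (\<lambda>x. - \<phi> x)" by (rule convex_on_subset) (use sub in auto)
  moreover have "s \<in> interior {0..r}" "t \<in> {0..r}" using s t r by (auto simp: interior_atLeastAtMost_real)
  moreover have "((\<lambda>x. - \<phi> x) has_field_derivative - deriv \<phi> s) (at s within {0..r})"
    using assms(1) s
    by (intro DERIV_minus has_field_derivative_at_within[OF DERIV_deriv_iff_real_differentiable[THEN iffD2]])
      (auto simp: desingularizing_def)
  ultimately have "- \<phi> t - (- \<phi> s) \<ge> - deriv \<phi> s * (t - s)"
    by (intro convex_on_imp_above_tangent[where A = "{0..r}"]) auto
  then show ?thesis by (simp add: algebra_simps)
qed

text \<open>Here \<open>s\<close> is the gap to the limit value at the current point and
  \<open>t\<close> the gap at the next one. The KL inequality gives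
  \<open>deriv \<phi> s * norm g \<ge> 1\<close>, and concavity turns the drop of the gap into a
  drop of \<open>\<phi>\<close>.\<close>

lemma KL_property_step:
  assumes ineq: "1 \<le> ereal (deriv \<phi> (real_of_ereal (f x - f x0))) * edist 0 (subdiff f x)"
    and fin: "f x0 = ereal c" "f x = ereal (c + s)"
    and \<phi>: "desingularizing \<eta> \<phi>" and s: "0 < s" "ereal s < \<eta>" and t: "0 \<le> t" "t \<le> s"
    and g: "g \<in> subdiff f x"
  shows "s - t \<le> norm g * (\<phi> s - \<phi> t)"
proof -
  have pos: "0 < deriv \<phi> s" using \<phi> s by (simp add: desingularizing_def)
  have "edist 0 (subdiff f x) \<le> ereal (norm g)"
    unfolding edist_def using g by (auto intro: INF_lower2)
  then have "ereal (deriv \<phi> s) * edist 0 (subdiff f x) \<le> ereal (deriv \<phi> s) * ereal (norm g)"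
    using pos by (intro ereal_mult_left_mono) auto
  moreover have "1 \<le> ereal (deriv \<phi> s) * edist 0 (subdiff f x)" using ineq fin by simp
  ultimately have "1 \<le> ereal (deriv \<phi> s) * ereal (norm g)" by (rule order.trans[rotated])
  then have "1 \<le> deriv \<phi> s * norm g" by simp
  then have "s - t \<le> (deriv \<phi> s * norm g) * (s - t)"
    using t by (simp add: mult_le_cancel_right1)
  also have "\<dots> = norm g * (deriv \<phi> s * (s - t))" by simp
  also have "\<dots> \<le> norm g * (\<phi> s - \<phi> t)"
    by (intro mult_left_mono desingularizing_concave_step[OF \<phi> s t]) simp
  finally show ?thesis .
qed

lemma contracting_recursion_tendsto_0:
  fixes e u :: "nat \<Rightarrow> real"
  assumes e: "\<And>k. 0 \<le> e k" and rec: "\<And>k. e (Suc k) \<le> \<rho> * e k + u k"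
    and \<rho>: "0 \<le> \<rho>" "\<rho> < 1" and u: "u \<longlonglongrightarrow> 0"
  shows "e \<longlonglongrightarrow> 0"
proof -
  have u': "\<forall>\<^sub>F k in sequentially. e k < \<epsilon>" if "\<epsilon> > 0" for \<epsilon>
  proof -
    \<comment> \<open>With this choice \<open>\<epsilon> / 2\<close> is the fixed point of the map
      sending \<open>t\<close> to \<open>\<rho> * t + \<delta>\<close>.\<close>
    define \<delta> where "\<delta> = (1 - \<rho>) * \<epsilon> / 2"
    have \<delta>: "\<delta> > 0" using \<rho> that by (simp add: \<delta>_def)
    obtain N where N: "\<And>k. k \<ge> N \<Longrightarrow> u k < \<delta>"
      using order_tendstoD(2)[OF u \<delta>] by (auto simp: eventually_sequentially)
    have bound: "e (N + k) \<le> \<rho> ^ k * e N + \<epsilon> / 2" for k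
    proof (induction k)
      case 0
      then show ?case using that by simp
    next
      case (Suc k)
      have "e (N + Suc k) \<le> \<rho> * e (N + k) + \<delta>"
        using rec[of "N + k"] N[of "N + k"] by simp
      also have "\<dots> \<le> \<rho> * (\<rho> ^ k * e N + \<epsilon> / 2) + \<delta>"
        using Suc \<rho> by (intro add_right_mono mult_left_mono)
      also have "\<dots> = \<rho> ^ Suc k * e N + \<epsilon> / 2" by (simp add: \<delta>_def field_simps)
      finally show ?case .
    qed
    have "(\<lambda>k. \<rho> ^ k * e N + \<epsilon> / 2) \<longlonglongrightarrow> 0 * e N + \<epsilon> / 2"
      using \<rho> by (intro tendsto_intros LIMSEQ_power_zero) auto
    then have "\<forall>\<^sub>F k in sequentially. \<rho> ^ k * e N + \<epsilon> / 2 < \<epsilon>"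
      by (rule order_tendstoD(2)) (use that in simp)
    then have "\<forall>\<^sub>F k in sequentially. e (N + k) < \<epsilon>"
      by eventually_elim (rule le_less_trans[OF bound])
    then show ?thesis
      using eventually_sequentially_seg[where P = "\<lambda>k. e k < \<epsilon>" and k = N] by (simp add: add.commute)
  qed
  show ?thesis
    using u' e by (intro order_tendstoI) (auto intro!: always_eventually less_le_trans[OF _ e])
qed

text \<open>Continuity at 0 is known only within the domain of \<open>\<phi>\<close>, and its filter
  omits the terms with \<open>s k = 0\<close>; these are covered by
  \<open>\<phi> 0 = 0\<close>.\<close>

lemma desingularizing_tendsto_0:
  assumes \<phi>: "desingularizing \<eta> \<phi>" and s: "s \<longlonglongrightarrow> 0"
    and ev: "\<forall>\<^sub>F k in sequentially. 0 \<le> s k \<and> ereal (s k) < \<eta>"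
  shows "(\<lambda>k. \<phi> (s k)) \<longlonglongrightarrow> 0"
proof -
  have "(\<phi> \<longlongrightarrow> \<phi> 0) (at 0 within {x. 0 \<le> x \<and> ereal x < \<eta>})" and 0: "\<phi> 0 = 0"
    using \<phi> by (auto simp: desingularizing_def continuous_within)
  then have "\<forall>\<^sub>F x in at 0 within {x. 0 \<le> x \<and> ereal x < \<eta>}. P (\<phi> x)"
    if "P 0" "open (Collect P)" for P
    using that topological_tendstoD[of \<phi> "\<phi> 0" _ "Collect P"] by simp
  then have *: "\<forall>\<^sub>F x in nhds 0. 0 \<le> x \<and> ereal x < \<eta> \<longrightarrow> P (\<phi> x)"
    if "P 0" "open (Collect P)" for P
    using that 0 unfolding eventually_at_filter
    by (force elim: eventually_mono)
  have **: "\<forall>\<^sub>F k in sequentially. P (\<phi> (s k))" if "P 0" "open (Collect P)" for P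
    using eventually_compose_filterlim[OF *[OF that] s] ev by eventually_elim simp
  show ?thesis
    by (rule topological_tendstoI) (use **[of "\<lambda>x. x \<in> _"] in auto)
qed

text \<open>The Kurdyka--Lojasiewicz inequality turns the decrease of \<open>f\<close> into the decrease of
  \<open>W k = K * \<phi> (F (k + 1) - F0) + x (k + 1) + e k + Q * e (k + 1)\<close>, which dominates the length of the
  next step as long as the iterate is near the cluster point; an iterate that enters a small ball
  with \<open>W\<close> small can therefore never leave it.\<close>

theorem KL_descent_converges:
  fixes w :: "nat \<Rightarrow> 'a::euclidean_space" and f :: "'a \<Rightarrow> ereal"
    and F x e :: "nat \<Rightarrow> real" and g :: "nat \<Rightarrow> 'a"
  assumes F: "\<And>k. f (w k) = ereal (F k)"
    and nonneg: "\<And>k. 0 \<le> x k" "\<And>k. 0 \<le> e k" and "0 < a" "0 \<le> b" "0 \<le> c" "0 < c'" "0 \<le> \<rho>" "\<rho> < 1"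
    and decrease: "\<And>k. a * (x (Suc k))\<^sup>2 \<le> F k - F (Suc k)"
    and error: "\<And>k. e (Suc k) \<le> \<rho> * e k + c * x (Suc k)"
    and g: "\<And>k. g (Suc k) \<in> subdiff f (w (Suc k))" "\<And>k. norm (g (Suc k)) \<le> b * (e k + x (Suc k))"
    and step: "\<And>k. dist (w (Suc k)) (w k) \<le> c' * (e k + x (Suc k))"
    and \<sigma>: "strict_mono \<sigma>" "(\<lambda>k. w (\<sigma> k)) \<longlonglongrightarrow> w0" "F \<longlonglongrightarrow> F0" and f0: "f w0 = ereal F0"
    and x0: "x \<longlonglongrightarrow> 0" and e0: "e \<longlonglongrightarrow> 0"
    and KL: "KL_property f w0"
  shows "w \<longlonglongrightarrow> w0"
proof -
  obtain \<eta> V \<phi> where "0 < \<eta>" and V: "w0 \<in> interior V" and \<phi>: "desingularizing \<eta> \<phi>"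
    and ineq: "\<And>y. y \<in> V \<Longrightarrow> f w0 < f y \<Longrightarrow> f y < f w0 + \<eta> \<Longrightarrow>
           1 \<le> ereal (deriv \<phi> (real_of_ereal (f y - f w0))) * edist 0 (subdiff f y)"
    using KL unfolding KL_property_def by blast
  obtain R where R: "R > 0" "ball w0 R \<subseteq> V"
    using V unfolding mem_interior by blast
  have F_Suc: "F (Suc k) \<le> F k" for k
    using decrease[of k] \<open>0 < a\<close> by (meson diff_ge_0_iff_ge dual_order.trans mult_nonneg_nonneg order_less_imp_le zero_le_power2)
  then have F_ge: "F0 \<le> F k" for k
    using \<sigma>(3) by (intro decseq_ge) (auto simp: decseq_Suc_iff)
  define s where "s k = F k - F0" for k
  have s: "0 \<le> s k" "s (Suc k) \<le> s k" "f (w k) = ereal (F0 + s k)" for k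
    using F_ge[of k] F_Suc[of k] F[of k] by (auto simp: s_def)
  have "s \<longlonglongrightarrow> 0" using \<sigma>(3) by (simp add: s_def[abs_def] LIM_zero)
  moreover have ev: "\<forall>\<^sub>F k in sequentially. ereal (s k) < \<eta>"
    using \<open>s \<longlonglongrightarrow> 0\<close> \<open>0 < \<eta>\<close> by (intro order_tendstoD(2)[where y = 0]) (auto simp: zero_ereal_def)
  ultimately have \<phi>0: "(\<lambda>k. \<phi> (s k)) \<longlonglongrightarrow> 0"
    by (intro desingularizing_tendsto_0[OF \<phi>]) (auto simp: s elim: eventually_mono)
  \<comment> \<open>Since \<open>Q * (1 - \<rho>) = 2\<close>, the drop of \<open>Q * e\<close> pays
    once for the new \<open>e\<close> term of \<open>W\<close> and once for the step length.
    \<open>M\<close> covers the costs \<open>1 + Q * c\<close> of the new \<open>x\<close> and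
    leaves one copy of it, and \<open>K\<close> is the constant that the AM-GM step below asks
    for.\<close>
  define Q where "Q = 2 / (1 - \<rho>)"
  define M where "M = 2 + Q * c"
  define K where "K = M * (b * M / (4 * a))"
  have Q: "Q > 0" "Q * (1 - \<rho>) = 2" using \<open>\<rho> < 1\<close> by (simp_all add: Q_def divide_eq_eq)
  have M: "M > 0" using Q \<open>0 \<le> c\<close> by (auto simp: M_def intro: add_pos_nonneg)
  have K: "K \<ge> 0" using M \<open>0 < a\<close> \<open>0 \<le> b\<close> by (simp add: K_def)
  define W where "W k = K * \<phi> (s (Suc k)) + x (Suc k) + e k + Q * e (Suc k)" for k
  have W_nonneg: "0 \<le> W k" if "ereal (s (Suc k)) < \<eta>" for k
    using that \<phi> s(1)[of "Suc k"] K Q nonneg by (auto simp: W_def desingularizing_def)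
  have W0: "W \<longlonglongrightarrow> 0"
  proof -
    have "W \<longlonglongrightarrow> K * 0 + 0 + 0 + Q * 0"
      unfolding W_def
      by (intro tendsto_intros e0 LIMSEQ_Suc[OF x0] LIMSEQ_Suc[OF e0] LIMSEQ_Suc[OF \<phi>0])
    then show ?thesis by simp
  qed
  have progress: "M * x (Suc (Suc k)) \<le> x (Suc k) + e k + K * (\<phi> (s (Suc k)) - \<phi> (s (Suc (Suc k))))"
    if near: "dist (w (Suc k)) w0 < R" and small: "ereal (s (Suc k)) < \<eta>" for k
  proof (cases "s (Suc k) = 0")
    \<comment> \<open>The KL inequality says nothing at the limit value itself; there no decrease is
      left, so the next \<open>x\<close> vanishes.\<close>
    case True
    then have s2: "s (Suc (Suc k)) = 0" using s(1,2)[of "Suc (Suc k)"] s(2)[of "Suc k"] by (metis nle_le s(1))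
    then have "a * (x (Suc (Suc k)))\<^sup>2 \<le> 0" using decrease[of "Suc k"] True by (simp add: s_def)
    then have "x (Suc (Suc k)) = 0" using \<open>0 < a\<close> by (simp add: mult_le_0_iff)
    then show ?thesis using True s2 nonneg by simp
  next
    case False
    then have pos: "0 < s (Suc k)" using s(1)[of "Suc k"] by simp
    define \<delta> where "\<delta> = \<phi> (s (Suc k)) - \<phi> (s (Suc (Suc k)))"
    define p where "p = e k + x (Suc k)"
    define y where "y = x (Suc (Suc k))"
    have "p \<ge> 0" "y \<ge> 0" using nonneg by (auto simp: p_def y_def)
    have lt: "ereal (F0 + s (Suc k)) < ereal F0 + \<eta>"
      using small by (cases \<eta>) auto
    have "1 \<le> ereal (deriv \<phi> (real_of_ereal (f (w (Suc k)) - f w0))) * edist 0 (subdiff f (w (Suc k)))"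
      using near R(2) pos lt by (intro ineq) (auto simp: f0 s(3) dist_commute subset_iff)
    from KL_property_step[OF this f0 s(3) \<phi> pos small s(1) s(2) g(1)]
    have KLs: "s (Suc k) - s (Suc (Suc k)) \<le> norm (g (Suc k)) * \<delta>"
      unfolding \<delta>_def .
    \<comment> \<open>\<open>\<phi>\<close> is increasing, which is read off from the tangent
      inequality and the positive derivative.\<close>
    have "\<delta> \<ge> 0"
    proof (rule ccontr)
      assume "\<not> \<delta> \<ge> 0"
      have "0 \<le> deriv \<phi> (s (Suc k)) * (s (Suc k) - s (Suc (Suc k)))"
        using \<phi> pos small s(2)[of "Suc k"] by (auto simp: desingularizing_def less_imp_le)
      with \<open>\<not> \<delta> \<ge> 0\<close> desingularizing_concave_step[OF \<phi> pos small s(1) s(2)]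
      show False by (auto simp: \<delta>_def)
    qed
    have "a * y\<^sup>2 \<le> norm (g (Suc k)) * \<delta>"
      using decrease[of "Suc k"] KLs by (simp add: s_def y_def)
    also have "\<dots> \<le> (b * p) * \<delta>"
      using g(2)[of k] \<open>\<delta> \<ge> 0\<close> by (intro mult_right_mono) (auto simp: p_def)
    finally have y: "a * y\<^sup>2 \<le> b * p * \<delta>" .
    text \<open>AM-GM in the form \<open>M y \<le> 2 * sqrt (p * (K * \<delta>)) \<le> p + K * \<delta>\<close>.\<close>
    have "(M * y)\<^sup>2 = M\<^sup>2 / a * (a * y\<^sup>2)" using \<open>0 < a\<close> by (simp add: power_mult_distrib)
    also have "\<dots> \<le> M\<^sup>2 / a * (b * p * \<delta>)" using y \<open>0 < a\<close> by (intro mult_left_mono) auto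
    also have "\<dots> = 4 * p * (K * \<delta>)" using \<open>0 < a\<close> by (simp add: K_def field_simps power2_eq_square)
    also have "\<dots> \<le> (p + K * \<delta>)\<^sup>2"
      using zero_le_power2[of "p - K * \<delta>"] by (simp add: power2_eq_square algebra_simps)
    finally have "M * y \<le> p + K * \<delta>"
      by (rule power2_le_imp_le) (use \<open>p \<ge> 0\<close> K \<open>\<delta> \<ge> 0\<close> in simp)
    then show ?thesis by (simp add: p_def y_def \<delta>_def algebra_simps)
  qed
  have W_step: "dist (w (Suc (Suc k))) (w (Suc k)) \<le> c' * (W k - W (Suc k))"
    if "dist (w (Suc k)) w0 < R" "ereal (s (Suc k)) < \<eta>" for k
  proof -
    have "Q * e (Suc (Suc k)) \<le> Q * (\<rho> * e (Suc k) + c * x (Suc (Suc k)))"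
      using error[of "Suc k"] Q by (intro mult_left_mono) auto
    also have "\<dots> = Q * e (Suc k) - 2 * e (Suc k) + Q * c * x (Suc (Suc k))"
      using arg_cong[OF Q(2), of "\<lambda>t. t * e (Suc k)"] by (simp add: algebra_simps)
    finally have "e (Suc k) + x (Suc (Suc k)) \<le> W k - W (Suc k)"
      using progress[OF that] by (simp add: W_def M_def algebra_simps)
    then have "c' * (e (Suc k) + x (Suc (Suc k))) \<le> c' * (W k - W (Suc k))"
      using \<open>0 < c'\<close> by (intro mult_left_mono) auto
    with step[of "Suc k"] show ?thesis by linarith
  qed
  show ?thesis
  proof (rule metric_LIMSEQ_I)
    fix r :: real assume "0 < r"
    \<comment> \<open>Inside the ball of radius \<open>r'\<close> both the requested accuracy and
      the KL inequality hold.\<close>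
    define r' where "r' = min r R"
    have r': "0 < r'" "r' \<le> r" "r' \<le> R" using \<open>0 < r\<close> R by (auto simp: r'_def)
    have "\<forall>\<^sub>F k in sequentially. ereal (s (Suc k)) < \<eta>"
      using ev filterlim_Suc by (rule eventually_compose_filterlim)
    moreover have "\<forall>\<^sub>F k in sequentially. W k < r' / (2 * c')"
      using W0 r' \<open>0 < c'\<close> by (intro order_tendstoD(2)) auto
    ultimately have "\<forall>\<^sub>F k in sequentially. ereal (s (Suc k)) < \<eta> \<and> W k < r' / (2 * c')"
      by eventually_elim simp
    then obtain N where N: "\<And>k. k \<ge> N \<Longrightarrow> ereal (s (Suc k)) < \<eta>" "\<And>k. k \<ge> N \<Longrightarrow> W k < r' / (2 * c')"
      by (auto simp: eventually_sequentially)
    have "\<forall>\<^sub>F k in sequentially. dist (w (\<sigma> k)) w0 < r' / 2"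
      using tendstoD[OF \<sigma>(2), of "r' / 2"] r' by simp
    then obtain J where J: "\<And>k. k \<ge> J \<Longrightarrow> dist (w (\<sigma> k)) w0 < r' / 2"
      by (auto simp: eventually_sequentially)
    \<comment> \<open>\<open>W n\<close> controls the steps that start at \<open>w (Suc n)\<close>,
      so the entry index \<open>\<sigma> j\<close> needs a predecessor
      \<open>n \<ge> N\<close>.\<close>
    define j where "j = max J (Suc N)"
    have j: "j \<ge> Suc N" "dist (w (\<sigma> j)) w0 < r' / 2"
      using J[of j] by (auto simp: j_def)
    define n where "n = \<sigma> j - 1"
    have n: "n \<ge> N" "\<sigma> j = Suc n"
      using j(1) seq_suble[OF \<sigma>(1), of j] by (auto simp: n_def)
    \<comment> \<open>The entry point lies within \<open>r' / 2\<close> of \<open>w0\<close>, and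
      the telescoped later steps cost at most \<open>c' * W n < r' / 2\<close>; both facts must be
      carried through the induction together.\<close>
    have stay: "dist (w (Suc (n + k))) w0 \<le> dist (w (Suc n)) w0 + c' * (W n - W (n + k)) \<and>
        dist (w (Suc (n + k))) w0 < r'" for k
    proof (induction k)
      case 0
      then show ?case using j n r' by auto
    next
      case (Suc k)
      have "dist (w (Suc (n + Suc k))) w0 \<le> dist (w (Suc (Suc (n + k)))) (w (Suc (n + k))) + dist (w (Suc (n + k))) w0"
        using dist_triangle by simp
      also have "\<dots> \<le> c' * (W (n + k) - W (Suc (n + k))) + (dist (w (Suc n)) w0 + c' * (W n - W (n + k)))"
        using Suc r' N n by (intro add_mono W_step) auto
      finally have 1: "dist (w (Suc (n + Suc k))) w0 \<le> dist (w (Suc n)) w0 + c' * (W n - W (n + Suc k))"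
        by (simp add: algebra_simps)
      have "W n - W (n + Suc k) \<le> W n"
        using W_nonneg[of "n + Suc k"] N(1)[of "n + Suc k"] n by simp
      also have "\<dots> < r' / (2 * c')" using N n by simp
      finally have "c' * (W n - W (n + Suc k)) < c' * (r' / (2 * c'))"
        using \<open>0 < c'\<close> by (intro mult_strict_left_mono)
      also have "\<dots> = r' / 2" using \<open>0 < c'\<close> by simp
      finally show ?case using 1 j n by auto
    qed
    have "dist (w k) w0 < r" if "k \<ge> Suc n" for k
      using stay[of "k - Suc n"] that r' by simp
    then show "\<exists>no. \<forall>k\<ge>no. dist (w k) w0 < r" by blast
  qed
qed

section \<open>The alternating direction method of multipliers\<close>

lemma below_golden_ratio:
  fixes \<tau> :: real
  assumes "0 < \<tau>" "\<tau> < (1 + sqrt 5) / 2"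
  shows "0 < 1 + \<tau> - \<tau>\<^sup>2"
proof (cases "\<tau> \<le> 1")
  case True
  then have "\<tau>\<^sup>2 \<le> 1" using assms by (simp add: power_le_one)
  then show ?thesis using assms by simp
next
  case False
  \<comment> \<open>Completing the square turns the claim into
    \<open>(2 * \<tau> - 1)\<^sup>2 < 5\<close>; in this case the base is positive, so the bound on
    \<open>\<tau>\<close> may be squared.\<close>
  then have "(2 * \<tau> - 1)\<^sup>2 < (sqrt 5)\<^sup>2" using assms by (intro power_strict_mono) auto
  then show ?thesis by (simp add: power2_eq_square algebra_simps)
qed

lemma norm_sq_scaleR_add:
  fixes r m :: "'a::real_inner"
  shows "(norm (c *\<^sub>R r + m))\<^sup>2 = c\<^sup>2 * (r \<bullet> r) + 2 * c * (r \<bullet> m) + m \<bullet> m"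
  unfolding power2_norm_eq_inner by (simp add: inner_commute power2_eq_square algebra_simps)

text \<open>With \<open>m\<close> the Gram operator applied to the \<open>Z\<close>-increment and
  divided by \<open>\<beta>\<close>, the left side is, up to the factor \<open>\<beta>\<close>, the
  rise of the potential caused by the dual update and the \<open>theta\<close> term. The slack is a
  multiple of \<open>(norm (r - (1 / \<tau>) *\<^sub>R m))\<^sup>2\<close> for
  \<open>\<tau> \<le> 1\<close> and of \<open>(norm (r + m))\<^sup>2\<close> otherwise, which
  explains the two branches of \<open>theta\<close>.\<close>

lemma dual_residual_bound:
  fixes r m :: "'a::real_inner"
  assumes \<tau>: "0 < \<tau>" "0 < 1 + \<tau> - \<tau>\<^sup>2"
  shows "(\<tau> + theta \<tau>) * (norm ((1 - \<tau>) *\<^sub>R r + m))\<^sup>2 - theta \<tau> * (norm r)\<^sup>2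
    \<le> max (1 / \<tau>) (\<tau>\<^sup>2 / (1 + \<tau> - \<tau>\<^sup>2)) * (norm m)\<^sup>2"
proof -
  let ?d = "1 + \<tau> - \<tau>\<^sup>2"
  have expand: "(norm ((1 - \<tau>) *\<^sub>R r + m))\<^sup>2 = (1 - \<tau>)\<^sup>2 * (r \<bullet> r) + 2 * (1 - \<tau>) * (r \<bullet> m) + m \<bullet> m"
    by (rule norm_sq_scaleR_add)
  show ?thesis
  proof (cases "\<tau> \<le> 1")
    case True
    have "(\<tau> - 1) * \<tau>\<^sup>2 / ?d \<le> 0"
      using True \<tau> by (intro divide_nonpos_pos mult_nonpos_nonneg) auto
    then have \<theta>: "theta \<tau> = 1 - \<tau>" using True unfolding theta_def by linarith
    have "0 \<le> (1 - \<tau>) * \<tau> * (norm (r - (1 / \<tau>) *\<^sub>R m))\<^sup>2" using True \<tau> by simp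
    also have "\<dots> = (1 - \<tau>) * (r \<bullet> r) + 1 / \<tau> * (m \<bullet> m) - (norm ((1 - \<tau>) *\<^sub>R r + m))\<^sup>2"
      using \<tau>(1) unfolding expand power2_norm_eq_inner
      by (simp add: inner_simps inner_commute power2_eq_square field_simps)
    finally have "(\<tau> + theta \<tau>) * (norm ((1 - \<tau>) *\<^sub>R r + m))\<^sup>2 - theta \<tau> * (norm r)\<^sup>2 \<le> 1 / \<tau> * (norm m)\<^sup>2"
      by (simp add: \<theta> power2_norm_eq_inner)
    also have "\<dots> \<le> max (1 / \<tau>) (\<tau>\<^sup>2 / ?d) * (norm m)\<^sup>2"
      by (intro mult_right_mono) auto
    finally show ?thesis .
  next
    case False
    have "0 \<le> (\<tau> - 1) * \<tau>\<^sup>2 / ?d" using False \<tau> by simp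
    then have \<theta>: "theta \<tau> = (\<tau> - 1) * \<tau>\<^sup>2 / ?d" using False unfolding theta_def by linarith
    have \<tau>\<theta>: "\<tau> + theta \<tau> = \<tau> / ?d"
      using \<tau> unfolding \<theta> by (simp add: field_simps power2_eq_square)
    have "0 \<le> \<tau> / ?d * ((\<tau> - 1) * (norm (r + m))\<^sup>2)" using False \<tau> by simp
    also have "(\<tau> - 1) * (norm (r + m))\<^sup>2
        = (\<tau> - 1) * \<tau> * (r \<bullet> r) + \<tau> * (m \<bullet> m) - (norm ((1 - \<tau>) *\<^sub>R r + m))\<^sup>2"
      unfolding expand power2_norm_eq_inner
      by (simp add: inner_simps inner_commute power2_eq_square algebra_simps)
    also have "\<tau> / ?d * \<dots> = theta \<tau> * (norm r)\<^sup>2 + \<tau>\<^sup>2 / ?d * (norm m)\<^sup>2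
        - (\<tau> + theta \<tau>) * (norm ((1 - \<tau>) *\<^sub>R r + m))\<^sup>2"
      unfolding \<tau>\<theta> unfolding \<theta>
      by (simp add: power2_norm_eq_inner[of r] power2_norm_eq_inner[of m] power2_eq_square[of \<tau>] diff_divide_distrib add_divide_distrib algebra_simps)
    finally have "(\<tau> + theta \<tau>) * (norm ((1 - \<tau>) *\<^sub>R r + m))\<^sup>2 - theta \<tau> * (norm r)\<^sup>2 \<le> \<tau>\<^sup>2 / ?d * (norm m)\<^sup>2"
      by simp
    also have "\<dots> \<le> max (1 / \<tau>) (\<tau>\<^sup>2 / ?d) * (norm m)\<^sup>2"
      by (intro mult_right_mono) auto
    finally show ?thesis .
  qed
qed

lemma theta_ge: "1 - \<tau> \<le> theta \<tau>"
  by (simp add: theta_def)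

text \<open>The second entry of the maximum in \<open>beta_bar\<close> is the larger root of the
  quadratic in \<open>\<beta>\<close> given by the last claim. The first entry yields
  \<open>lambda_max A < \<beta>\<close> because
  \<open>max (1 / \<tau>) \<tau> \<ge> 1\<close>.\<close>

lemma beta_bar_less:
  assumes "linear A" "0 < \<tau>" "beta_bar A \<tau> < \<beta>"
  shows "lambda_max A < \<beta>" "0 < \<beta>"
    and "2 * max (1 / \<tau>) (\<tau>\<^sup>2 / (1 + \<tau> - \<tau>\<^sup>2)) * (lambda_max A)\<^sup>2 < \<beta> * (\<beta> + lambda_min A)"
proof -
  let ?M = "lambda_max A" and ?m = "lambda_min A"
  let ?\<gamma> = "max (1 / \<tau>) (\<tau>\<^sup>2 / (1 + \<tau> - \<tau>\<^sup>2))"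
  have "1 \<le> max (1 / \<tau>) \<tau>" using assms(2) by (cases "\<tau> \<le> 1") (auto simp: le_max_iff_disj)
  then have "?M \<le> max (1 / \<tau>) \<tau> * ?M"
    using lambda_max_nonneg[OF assms(1)] by (simp add: mult_le_cancel_right1)
  also have "\<dots> < \<beta>" using assms(3) by (simp add: beta_bar_def)
  finally show "?M < \<beta>" .
  with lambda_max_nonneg[OF assms(1)] show "0 < \<beta>" by simp
  let ?X = "?m\<^sup>2 + ?\<gamma> * (8 * ?M\<^sup>2)"
  have \<gamma>: "0 \<le> ?\<gamma>" using assms(2) by (simp add: le_max_iff_disj)
  then have X: "0 \<le> ?X" by (intro add_nonneg_nonneg mult_nonneg_nonneg) auto
  have "sqrt ?X < 2 * \<beta> + ?m" using assms(3) by (simp add: beta_bar_def)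
  then have "(sqrt ?X)\<^sup>2 < (2 * \<beta> + ?m)\<^sup>2" using X by (intro power_strict_mono) auto
  then have "?X < (2 * \<beta> + ?m)\<^sup>2" using X by simp
  then show "2 * ?\<gamma> * ?M\<^sup>2 < \<beta> * (\<beta> + ?m)"
    by (simp add: power2_eq_square algebra_simps)
qed

lemma ereal_cancel_finite_summand:
  fixes a b c :: ereal
  assumes "a + c + ereal u \<le> b + c + ereal v" "\<bar>c\<bar> \<noteq> \<infinity>"
  shows "a + ereal u \<le> b + ereal v"
  using assms by (cases a; cases b; cases c) auto

lemma bounded_linear_triple_bound:
  assumes "bounded_linear T"
  obtains K where "K > 0" "\<And>a b c. norm (T (a, b, c)) \<le> K * (norm a + (norm b + norm c))"
proof -
  obtain K where K: "K > 0" "\<And>x. norm (T x) \<le> norm x * K"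
    using bounded_linear.pos_bounded[OF assms] by blast
  have "norm (T (a, b, c)) \<le> K * (norm a + (norm b + norm c))" for a b c
  proof -
    have "norm (a, b, c) \<le> norm a + (norm b + norm c)"
      by (intro order.trans[OF norm_Pair_le] add_left_mono norm_Pair_le)
    then have "K * norm (a, b, c) \<le> K * (norm a + (norm b + norm c))"
      using K(1) by (intro mult_left_mono) auto
    with K(2)[of "(a, b, c)"] show ?thesis by (simp add: mult.commute)
  qed
  with K(1) show thesis by (rule that)
qed

lemma norm_mean_sq:
  fixes x y :: "'a::real_inner"
  shows "(norm ((1/2) *\<^sub>R x + (1/2) *\<^sub>R y))\<^sup>2 = 1/2 * (norm x)\<^sup>2 + 1/2 * (norm y)\<^sup>2 - 1/4 * (norm (x - y))\<^sup>2"
  by (simp add: power2_norm_eq_inner inner_simps inner_commute field_simps)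

text \<open>The argument speaks of inner products and linear maps only, hence an abstract Euclidean
  space instead of matrices; \<open>\<sigma>\<close> is a fixed witness of the lower bound on the
  Gram operator of \<open>B\<close>.\<close>

locale admm =
  fixes \<Psi> \<Phi> :: "'a::euclidean_space \<Rightarrow> ereal"
    and D :: 'a and A B C :: "'a \<Rightarrow> 'a" and \<tau> \<beta> \<sigma> :: real
    and L S Z \<Lambda> :: "nat \<Rightarrow> 'a"
  assumes lsc_Psi: "lsc \<Psi>" and Psi_nonneg: "\<And>X. 0 \<le> \<Psi> X" and convex_Psi: "econvex \<Psi>"
    and lsc_Phi: "lsc \<Phi>" and Phi_nonneg: "\<And>X. 0 \<le> \<Phi> X"
    and lin_A: "linear A" and lin_B: "linear B" and lin_C: "linear C" and inj_C: "inj C"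
    and tau: "0 < \<tau>" "\<tau> < (1 + sqrt 5) / 2"
    and beta: "beta_bar A \<tau> < \<beta>"
    and admm: "ADMM_sequence \<Psi> \<Phi> D A B C \<tau> \<beta> L S Z \<Lambda>"
    and sigma: "0 < \<sigma>" "loewner_ge (adjoint B \<circ> B) (\<lambda>X. \<sigma> *\<^sub>R X)"
    and start: "potential \<Psi> \<Phi> D A B C \<tau> \<beta> (L 1) (S 1) (Z 1) (\<Lambda> 1) < liminf_at_infinity \<Psi> \<Phi>"
begin

lemmas bl = lin_A[unfolded linear_conv_bounded_linear] lin_B[unfolded linear_conv_bounded_linear]
  lin_C[unfolded linear_conv_bounded_linear] adjoint_linear[OF lin_A, unfolded linear_conv_bounded_linear]
  adjoint_linear[OF lin_B, unfolded linear_conv_bounded_linear]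
  adjoint_linear[OF lin_C, unfolded linear_conv_bounded_linear]

lemmas bl_compose = bl[THEN bounded_linear_compose]
lemmas tendsto_maps = bl[THEN bounded_linear.tendsto]
lemmas continuous_on_maps = bl[THEN bounded_linear.continuous_on]
lemmas has_derivative_maps = bl[THEN bounded_linear.has_derivative]

lemmas A_simps = linear_add[OF lin_A] linear_diff[OF lin_A] linear_scale[OF lin_A] linear_neg[OF lin_A]
lemmas B_simps = linear_add[OF lin_B] linear_diff[OF lin_B] linear_scale[OF lin_B] linear_neg[OF lin_B]
lemmas C_simps = linear_add[OF lin_C] linear_diff[OF lin_C] linear_scale[OF lin_C] linear_neg[OF lin_C]
lemmas A'_simps = linear_add[OF adjoint_linear[OF lin_A]] linear_diff[OF adjoint_linear[OF lin_A]]
  linear_scale[OF adjoint_linear[OF lin_A]] linear_neg[OF adjoint_linear[OF lin_A]]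
lemmas B'_simps = linear_add[OF adjoint_linear[OF lin_B]] linear_diff[OF adjoint_linear[OF lin_B]]
  linear_scale[OF adjoint_linear[OF lin_B]] linear_neg[OF adjoint_linear[OF lin_B]]
lemmas C'_simps = linear_add[OF adjoint_linear[OF lin_C]] linear_diff[OF adjoint_linear[OF lin_C]]
  linear_scale[OF adjoint_linear[OF lin_C]] linear_neg[OF adjoint_linear[OF lin_C]]

lemmas beta_facts = beta_bar_less[OF lin_A tau(1) beta]

section \<open>Residual, potential and real-valued quantities along the iterates\<close>

definition resid :: "'a \<Rightarrow> 'a \<Rightarrow> 'a \<Rightarrow> 'a" where
  "resid l s z = B l + C s - z"

definition coupling :: "'a \<Rightarrow> 'a \<Rightarrow> 'a \<Rightarrow> 'a \<Rightarrow> real" where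
  "coupling l s z y = 1/2 * (norm (D - A z))\<^sup>2 - y \<bullet> resid l s z + \<beta>/2 * (norm (resid l s z))\<^sup>2"

definition smooth_part :: "'a \<times> 'a \<times> 'a \<times> 'a \<Rightarrow> real" where
  "smooth_part = (\<lambda>(l, s, z, y). coupling l s z y + theta \<tau> * \<beta> * (norm (resid l s z))\<^sup>2)"

definition merit :: "'a \<times> 'a \<times> 'a \<times> 'a \<Rightarrow> ereal" where
  "merit = (\<lambda>(l, s, z, y). \<Psi> l + \<Phi> s + ereal (smooth_part (l, s, z, y)))"

lemma aug_lagrangian_eq: "aug_lagrangian \<Psi> \<Phi> D A B C \<beta> l s z y = \<Psi> l + \<Phi> s + ereal (coupling l s z y)"
  by (simp add: aug_lagrangian_def coupling_def resid_def)

lemma potential_eq: "(\<lambda>(l, s, z, y). potential \<Psi> \<Phi> D A B C \<tau> \<beta> l s z y) = merit"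
  by (auto simp: fun_eq_iff merit_def smooth_part_def potential_def aug_lagrangian_eq resid_def add.assoc)

definition r :: "nat \<Rightarrow> 'a" where "r k = resid (L k) (S k) (Z k)"

text \<open>Indices are shifted by one: the sequence starts at the first computed iterate, where the
  potential is known to be finite. Accordingly \<open>F k\<close> and \<open>e k\<close> belong to
  \<open>w k\<close>, and \<open>x (Suc k)\<close> measures the move from \<open>w k\<close> to
  \<open>w (Suc k)\<close>; \<open>x 0\<close> would involve the arbitrary
  \<open>L 0\<close>.\<close>

definition w :: "nat \<Rightarrow> 'a \<times> 'a \<times> 'a \<times> 'a" where
  "w k = (L (Suc k), S (Suc k), Z (Suc k), \<Lambda> (Suc k))"

text \<open>\<open>real_of_ereal\<close> sends infinity to 0, so these are the true function values
  only where finiteness is known, namely at positive indices.\<close>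

definition \<psi> :: "nat \<Rightarrow> real" where "\<psi> k = real_of_ereal (\<Psi> (L k))"
definition \<phi> :: "nat \<Rightarrow> real" where "\<phi> k = real_of_ereal (\<Phi> (S k))"
definition F :: "nat \<Rightarrow> real" where "F k = \<psi> (Suc k) + \<phi> (Suc k) + smooth_part (w k)"
definition x :: "nat \<Rightarrow> real" where "x k = norm (L (Suc k) - L k) + norm (Z (Suc k) - Z k)"
definition e :: "nat \<Rightarrow> real" where "e k = norm (r (Suc k))"

lemma F_eq: "F k = \<psi> (Suc k) + \<phi> (Suc k) + coupling (L (Suc k)) (S (Suc k)) (Z (Suc k)) (\<Lambda> (Suc k))
    + theta \<tau> * \<beta> * (norm (r (Suc k)))\<^sup>2"
  by (simp add: F_def smooth_part_def w_def r_def)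

section \<open>Optimality conditions and the residual recursion\<close>

lemma L_min: "\<Psi> (L (Suc k)) + \<Phi> (S k) + ereal (coupling (L (Suc k)) (S k) (Z k) (\<Lambda> k))
    \<le> \<Psi> X + \<Phi> (S k) + ereal (coupling X (S k) (Z k) (\<Lambda> k))"
  and S_min: "\<Psi> (L (Suc k)) + \<Phi> (S (Suc k)) + ereal (coupling (L (Suc k)) (S (Suc k)) (Z k) (\<Lambda> k))
    \<le> \<Psi> (L (Suc k)) + \<Phi> X + ereal (coupling (L (Suc k)) X (Z k) (\<Lambda> k))"
  and Z_min: "\<Psi> (L (Suc k)) + \<Phi> (S (Suc k)) + ereal (coupling (L (Suc k)) (S (Suc k)) (Z (Suc k)) (\<Lambda> k))
    \<le> \<Psi> (L (Suc k)) + \<Phi> (S (Suc k)) + ereal (coupling (L (Suc k)) (S (Suc k)) X (\<Lambda> k))"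
  and Lambda_Suc: "\<Lambda> (Suc k) = \<Lambda> k - (\<tau> * \<beta>) *\<^sub>R r (Suc k)"
  using admm unfolding ADMM_sequence_def is_arg_min_def aug_lagrangian_eq r_def resid_def
  by (auto simp: not_less)

text \<open>The first potential lies strictly below some extended real, hence is finite. Afterwards
  each minimizer is compared with the previous iterate.\<close>

lemma finite_values: "\<bar>\<Psi> (L (Suc k))\<bar> \<noteq> \<infinity> \<and> \<bar>\<Phi> (S (Suc k))\<bar> \<noteq> \<infinity>"
proof (induction k)
  case 0
  have "merit (w 0) < \<infinity>"
    using start less_ereal.simps(2) unfolding potential_eq[symmetric] w_def
    by (auto intro: less_le_trans)
  then show ?case
    using Psi_nonneg[of "L 1"] Phi_nonneg[of "S 1"]
    by (cases "\<Psi> (L 1)"; cases "\<Phi> (S 1)") (auto simp: merit_def w_def)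
next
  case (Suc k)
  have 1: "\<bar>\<Psi> (L (Suc (Suc k)))\<bar> \<noteq> \<infinity>"
    using L_min[of "Suc k" "L (Suc k)"] Suc Psi_nonneg[of "L (Suc (Suc k))"]
    by (cases "\<Psi> (L (Suc (Suc k)))"; cases "\<Psi> (L (Suc k))"; cases "\<Phi> (S (Suc k))") auto
  moreover have "\<bar>\<Phi> (S (Suc (Suc k)))\<bar> \<noteq> \<infinity>"
    using S_min[of "Suc k" "S (Suc k)"] Suc 1 Phi_nonneg[of "S (Suc (Suc k))"]
    by (cases "\<Phi> (S (Suc (Suc k)))"; cases "\<Psi> (L (Suc (Suc k)))"; cases "\<Phi> (S (Suc k))") auto
  ultimately show ?case by simp
qed

lemma Psi_L: "\<Psi> (L (Suc k)) = ereal (\<psi> (Suc k))" and Phi_S: "\<Phi> (S (Suc k)) = ereal (\<phi> (Suc k))"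
  using finite_values[of k] by (auto simp: \<psi>_def \<phi>_def ereal_real)

lemma psi_nonneg: "0 \<le> \<psi> k" and phi_nonneg: "0 \<le> \<phi> k"
  using Psi_nonneg Phi_nonneg by (auto simp: \<psi>_def \<phi>_def real_of_ereal_pos)

lemma merit_w: "merit (w k) = ereal (F k)"
  using Psi_L[of k] Phi_S[of k] by (simp add: merit_def w_def F_def)

text \<open>The summand \<open>\<Phi> (S (Suc k))\<close> is finite and can be cancelled; at the
  initial point it might be infinite, hence the shifted index.\<close>

lemma L_opt: "\<Psi> (L (Suc (Suc k))) + ereal (coupling (L (Suc (Suc k))) (S (Suc k)) (Z (Suc k)) (\<Lambda> (Suc k)))
    \<le> \<Psi> X + ereal (coupling X (S (Suc k)) (Z (Suc k)) (\<Lambda> (Suc k)))"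
  by (rule ereal_cancel_finite_summand[OF L_min]) (use finite_values[of k] in simp)

lemma S_opt: "\<Phi> (S (Suc (Suc k))) + ereal (coupling (L (Suc (Suc k))) (S (Suc (Suc k))) (Z (Suc k)) (\<Lambda> (Suc k)))
    \<le> \<Phi> X + ereal (coupling (L (Suc (Suc k))) X (Z (Suc k)) (\<Lambda> (Suc k)))"
proof (rule ereal_cancel_finite_summand)
  show "\<bar>\<Psi> (L (Suc (Suc k)))\<bar> \<noteq> \<infinity>" using finite_values[of "Suc k"] by simp
qed (use S_min[of "Suc k" X] in \<open>simp add: add.commute\<close>)

text \<open>The coupling is quadratic in \<open>z\<close>, so its second-order expansion is exact.
  Both the optimality condition and the decrease of the \<open>Z\<close>-step are read off from
  it.\<close>

lemma coupling_Z_expand: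
  "coupling l s (z + h) y = coupling l s z y + h \<bullet> (adjoint A (A z - D) + y - \<beta> *\<^sub>R resid l s z)
    + 1/2 * (norm (A h))\<^sup>2 + \<beta>/2 * (norm h)\<^sup>2"
proof -
  have res: "resid l s (z + h) = resid l s z - h" by (simp add: resid_def)
  have D: "D - A (z + h) = (D - A z) - A h" by (simp add: A_simps)
  have adj: "h \<bullet> adjoint A (A z - D) = - (A h \<bullet> (D - A z))"
    by (simp add: adjoint_clauses[OF lin_A] inner_diff_right)
  have sq: "(norm (a - b))\<^sup>2 = (norm a)\<^sup>2 - 2 * (b \<bullet> a) + (norm b)\<^sup>2" for a b :: 'a
    by (simp add: power2_norm_eq_inner inner_diff inner_commute)
  show ?thesis
    unfolding coupling_def res D sq inner_add_right inner_diff_right adj inner_scaleR_right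
    by (simp add: field_simps inner_commute)
qed

lemma Z_opt: "adjoint A (A (Z (Suc k)) - D) + \<Lambda> k - \<beta> *\<^sub>R r (Suc k) = 0" (is "?G = 0")
proof -
  have min: "coupling (L (Suc k)) (S (Suc k)) (Z (Suc k)) (\<Lambda> k)
      \<le> coupling (L (Suc k)) (S (Suc k)) X (\<Lambda> k)" for X
    using Z_min[of k X] finite_values[of k] by (cases "\<Psi> (L (Suc k))"; cases "\<Phi> (S (Suc k))") auto
  define G where "G = ?G"
  \<comment> \<open>The trial points leave the minimizer along the gradient \<open>G\<close> itself,
    where the slope is \<open>G \<bullet> G\<close>.\<close>
  have "0 \<le> 2 * t * (G \<bullet> G / 2) + t\<^sup>2 * (1/2 * (norm (A G))\<^sup>2 + \<beta>/2 * (norm G)\<^sup>2)" for t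
    using min[of "Z (Suc k) + t *\<^sub>R G"] unfolding coupling_Z_expand r_def[symmetric] G_def[symmetric]
    by (simp add: linear_scale[OF lin_A] power_mult_distrib algebra_simps)
  then have "G \<bullet> G / 2 = 0" by (rule linear_coeff_eq_0)
  then show ?thesis by (simp add: G_def)
qed

lemma Lambda_eq: "\<Lambda> (Suc k) = ((1 - \<tau>) * \<beta>) *\<^sub>R r (Suc k) - adjoint A (A (Z (Suc k)) - D)"
proof -
  have "\<Lambda> k = \<beta> *\<^sub>R r (Suc k) - adjoint A (A (Z (Suc k)) - D)"
    using Z_opt[of k] by (simp add: algebra_simps)
  then show ?thesis
    unfolding Lambda_Suc[of k] by (simp add: algebra_simps)
qed

definition resid_step :: "'a \<Rightarrow> 'a \<Rightarrow> 'a" where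
  "resid_step u z = (1 - \<tau>) *\<^sub>R u + (1 / \<beta>) *\<^sub>R adjoint A (A z)"

text \<open>Subtract \<open>Lambda_eq\<close> at consecutive indices and replace the increment of
  the multiplier by the dual update.\<close>

lemma r_Suc: "r (Suc (Suc k)) = resid_step (r (Suc k)) (Z (Suc (Suc k)) - Z (Suc k))"
proof -
  have "\<beta> *\<^sub>R r (Suc (Suc k)) = ((1 - \<tau>) * \<beta>) *\<^sub>R r (Suc k) + adjoint A (A (Z (Suc (Suc k)) - Z (Suc k)))"
    using Lambda_Suc[of "Suc k"] Lambda_eq[of k] Lambda_eq[of "Suc k"]
    by (simp add: A_simps A'_simps algebra_simps)
  then have "(1 / \<beta>) *\<^sub>R (\<beta> *\<^sub>R r (Suc (Suc k))) = (1 / \<beta>) *\<^sub>R \<dots>" by simp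
  then show ?thesis
    using beta_facts(2) by (simp add: resid_step_def scaleR_add_right)
qed

lemma error: "e (Suc k) \<le> \<bar>1 - \<tau>\<bar> * e k + lambda_max A / \<beta> * x (Suc k)"
proof -
  let ?z = "Z (Suc (Suc k)) - Z (Suc k)"
  have "e (Suc k) \<le> \<bar>1 - \<tau>\<bar> * e k + 1 / \<beta> * norm (adjoint A (A ?z))"
    using norm_triangle_ineq[of "(1 - \<tau>) *\<^sub>R r (Suc k)" "(1 / \<beta>) *\<^sub>R adjoint A (A ?z)"] beta_facts(2)
    by (simp add: e_def r_Suc resid_step_def)
  also have "\<dots> \<le> \<bar>1 - \<tau>\<bar> * e k + 1 / \<beta> * (lambda_max A * norm ?z)"
    using beta_facts(2) by (intro add_left_mono mult_left_mono norm_gram_le lin_A) auto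
  also have "\<dots> \<le> \<bar>1 - \<tau>\<bar> * e k + 1 / \<beta> * (lambda_max A * x (Suc k))"
    using beta_facts(2) lambda_max_nonneg[OF lin_A]
    by (intro add_left_mono mult_left_mono) (auto simp: x_def)
  finally show ?thesis by simp
qed

section \<open>Sufficient decrease of the potential\<close>

text \<open>Comparing the minimizer with the midpoint of the two iterates already yields a quadratic
  decrease.\<close>

lemma L_descent:
  "\<psi> (Suc (Suc k)) + coupling (L (Suc (Suc k))) (S (Suc k)) (Z (Suc k)) (\<Lambda> (Suc k))
    \<le> \<psi> (Suc k) + coupling (L (Suc k)) (S (Suc k)) (Z (Suc k)) (\<Lambda> (Suc k))
      - \<beta>/4 * (norm (B (L (Suc (Suc k)) - L (Suc k))))\<^sup>2"
proof -
  let ?a = "L (Suc k)" and ?b = "L (Suc (Suc k))"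
  let ?q = "\<lambda>X. coupling X (S (Suc k)) (Z (Suc k)) (\<Lambda> (Suc k))"
  let ?mid = "(1/2) *\<^sub>R ?a + (1/2) *\<^sub>R ?b"
  have "\<Psi> ?mid \<le> ereal (1/2 * \<psi> (Suc k) + 1/2 * \<psi> (Suc (Suc k)))"
    using convex_Psi[unfolded econvex_def, rule_format, of "1/2" ?a ?b] Psi_L[of k] Psi_L[of "Suc k"] by simp
  then have mid: "\<Psi> ?mid + ereal (?q ?mid) \<le> ereal (1/2 * \<psi> (Suc k) + 1/2 * \<psi> (Suc (Suc k)) + ?q ?mid)"
    by (cases "\<Psi> ?mid") auto
  have 1: "\<psi> (Suc (Suc k)) + ?q ?b \<le> 1/2 * \<psi> (Suc k) + 1/2 * \<psi> (Suc (Suc k)) + ?q ?mid"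
    using order.trans[OF L_opt mid] unfolding Psi_L by simp
  have res: "resid ?mid (S (Suc k)) (Z (Suc k)) =
      (1/2) *\<^sub>R resid ?a (S (Suc k)) (Z (Suc k)) + (1/2) *\<^sub>R resid ?b (S (Suc k)) (Z (Suc k))"
  proof -
    let ?c = "C (S (Suc k)) - Z (Suc k)"
    have "?c = (1/2) *\<^sub>R ?c + (1/2) *\<^sub>R ?c" by (simp flip: scaleR_add_left)
    moreover have "resid ?mid (S (Suc k)) (Z (Suc k)) = ((1/2) *\<^sub>R B ?a + (1/2) *\<^sub>R B ?b) + ?c"
      by (simp add: resid_def B_simps)
    ultimately have "resid ?mid (S (Suc k)) (Z (Suc k)) =
        ((1/2) *\<^sub>R B ?a + (1/2) *\<^sub>R B ?b) + ((1/2) *\<^sub>R ?c + (1/2) *\<^sub>R ?c)" by simp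
    also have "\<dots> = (1/2) *\<^sub>R (B ?a + ?c) + (1/2) *\<^sub>R (B ?b + ?c)"
      unfolding scaleR_add_right by (simp only: ac_simps)
    finally show ?thesis by (simp add: resid_def add_diff_eq)
  qed
  have diff: "resid ?a (S (Suc k)) (Z (Suc k)) - resid ?b (S (Suc k)) (Z (Suc k)) = - B (?b - ?a)"
    by (simp add: resid_def B_simps)
  \<comment> \<open>The quadratic term gains \<open>\<beta>/8\<close> at the midpoint; doubling the
    averaged inequality turns this into \<open>\<beta>/4\<close>.\<close>
  have "?q ?mid = 1/2 * ?q ?a + 1/2 * ?q ?b - \<beta>/8 * (norm (B (?b - ?a)))\<^sup>2"
    unfolding coupling_def res norm_mean_sq diff by (simp add: inner_simps algebra_simps)
  with 1 show ?thesis by linarith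
qed

text \<open>Without convexity of \<open>\<Phi>\<close> the midpoint comparison fails, so no
  quadratic gain is claimed; the \<open>S\<close>-increment is recovered later from the
  residuals.\<close>

lemma S_descent:
  "\<phi> (Suc (Suc k)) + coupling (L (Suc (Suc k))) (S (Suc (Suc k))) (Z (Suc k)) (\<Lambda> (Suc k))
    \<le> \<phi> (Suc k) + coupling (L (Suc (Suc k))) (S (Suc k)) (Z (Suc k)) (\<Lambda> (Suc k))"
  using S_opt[of k "S (Suc k)"] unfolding Phi_S by simp

text \<open>Expanding about the minimizer removes the linear term by \<open>Z_opt\<close>.\<close>

lemma Z_descent:
  "coupling (L (Suc k)) (S (Suc k)) (Z (Suc k)) (\<Lambda> k) = coupling (L (Suc k)) (S (Suc k)) (Z k) (\<Lambda> k)
    - 1/2 * (norm (A (Z (Suc k) - Z k)))\<^sup>2 - \<beta>/2 * (norm (Z (Suc k) - Z k))\<^sup>2"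
proof -
  let ?h = "Z k - Z (Suc k)"
  have "norm (A (Z (Suc k) - Z k)) = norm (A ?h)" "norm (Z (Suc k) - Z k) = norm ?h"
    by (simp_all add: linear_diff[OF lin_A] norm_minus_commute)
  moreover have "coupling (L (Suc k)) (S (Suc k)) (Z (Suc k) + ?h) (\<Lambda> k) =
      coupling (L (Suc k)) (S (Suc k)) (Z (Suc k)) (\<Lambda> k) + 1/2 * (norm (A ?h))\<^sup>2 + \<beta>/2 * (norm ?h)\<^sup>2"
    unfolding coupling_Z_expand r_def[symmetric] Z_opt by simp
  ultimately show ?thesis by simp
qed

lemma Lambda_ascent:
  "coupling (L (Suc k)) (S (Suc k)) (Z (Suc k)) (\<Lambda> (Suc k))
    = coupling (L (Suc k)) (S (Suc k)) (Z (Suc k)) (\<Lambda> k) + \<tau> * \<beta> * (norm (r (Suc k)))\<^sup>2"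
  unfolding coupling_def r_def[symmetric] Lambda_Suc[of k]
  by (simp add: inner_simps power2_norm_eq_inner)

lemma norm_B_ge: "\<sigma> * (norm h)\<^sup>2 \<le> (norm (B h))\<^sup>2"
  using sigma(2)[unfolded loewner_ge_def, rule_format, of h]
  by (simp add: inner_diff_right inner_gram[OF lin_B] power2_norm_eq_inner[of h])

text \<open>The dual update raises the Lagrangian. \<open>dual_residual_bound\<close> charges this
  rise, net of the change of the \<open>theta\<close> term, to the \<open>Z\<close>-increment, and
  the quadratic gain of the \<open>Z\<close>-step more than pays for it.\<close>

lemma sufficient_decrease:
  obtains a where "0 < a" "\<And>k. a * (x (Suc k))\<^sup>2 \<le> F k - F (Suc k)"
proof -
  let ?\<gamma> = "max (1 / \<tau>) (\<tau>\<^sup>2 / (1 + \<tau> - \<tau>\<^sup>2))"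
  define a1 where "a1 = \<beta> * \<sigma> / 4"
  \<comment> \<open>Net gain per unit of the squared \<open>Z\<close>-increment; its positivity is
    the quadratic inequality in \<open>beta_facts\<close>.\<close>
  define a2 where "a2 = (lambda_min A + \<beta>) / 2 - ?\<gamma> * (lambda_max A)\<^sup>2 / \<beta>"
  \<comment> \<open>The half accounts for the square of a sum being at most twice the sum of the
    squares.\<close>
  define a where "a = min a1 a2 / 2"
  have "0 < a1" using beta_facts(2) sigma by (simp add: a1_def)
  moreover have "0 < a2"
    using beta_facts(2,3) by (simp add: a2_def field_simps power2_eq_square)
  ultimately have "0 < a" by (simp add: a_def)
  moreover have "a * (x (Suc k))\<^sup>2 \<le> F k - F (Suc k)" for k
  proof -
    let ?l = "L (Suc (Suc k)) - L (Suc k)" and ?z = "Z (Suc (Suc k)) - Z (Suc k)"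
    let ?m = "(1 / \<beta>) *\<^sub>R adjoint A (A ?z)"
    have "(norm ?m)\<^sup>2 \<le> (lambda_max A * norm ?z / \<beta>)\<^sup>2"
      using norm_gram_le[OF lin_A, of ?z] beta_facts(2)
      by (intro power_mono) (auto simp: divide_right_mono)
    then have "?\<gamma> * (norm ?m)\<^sup>2 \<le> ?\<gamma> * (lambda_max A * norm ?z / \<beta>)\<^sup>2"
      using tau by (intro mult_left_mono) (auto simp: le_max_iff_disj)
    with dual_residual_bound[OF tau(1) below_golden_ratio[OF tau], of "r (Suc k)" ?m]
    have "(\<tau> + theta \<tau>) * (norm (r (Suc (Suc k))))\<^sup>2 - theta \<tau> * (norm (r (Suc k)))\<^sup>2
        \<le> ?\<gamma> * (lambda_max A * norm ?z / \<beta>)\<^sup>2"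
      unfolding r_Suc resid_step_def by linarith
    then have "\<beta> * ((\<tau> + theta \<tau>) * (norm (r (Suc (Suc k))))\<^sup>2 - theta \<tau> * (norm (r (Suc k)))\<^sup>2)
        \<le> \<beta> * (?\<gamma> * (lambda_max A * norm ?z / \<beta>)\<^sup>2)"
      using beta_facts(2) by (intro mult_left_mono) auto
    also have "\<dots> = ?\<gamma> * (lambda_max A)\<^sup>2 / \<beta> * (norm ?z)\<^sup>2"
      using beta_facts(2) by (simp add: power_mult_distrib power_divide power2_eq_square)
    finally have res: "\<tau> * \<beta> * (norm (r (Suc (Suc k))))\<^sup>2 + theta \<tau> * \<beta> * (norm (r (Suc (Suc k))))\<^sup>2
        - theta \<tau> * \<beta> * (norm (r (Suc k)))\<^sup>2 \<le> ?\<gamma> * (lambda_max A)\<^sup>2 / \<beta> * (norm ?z)\<^sup>2"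
      by (simp add: algebra_simps)
    have "\<beta> / 4 * (\<sigma> * (norm ?l)\<^sup>2) \<le> \<beta> / 4 * (norm (B ?l))\<^sup>2"
      using beta_facts(2) by (intro mult_left_mono norm_B_ge) auto
    then have "a1 * (norm ?l)\<^sup>2 \<le> \<beta> / 4 * (norm (B ?l))\<^sup>2" by (simp add: a1_def)
    moreover have "a2 * (norm ?z)\<^sup>2 \<le> 1/2 * (norm (A ?z))\<^sup>2 + \<beta>/2 * (norm ?z)\<^sup>2 - ?\<gamma> * (lambda_max A)\<^sup>2 / \<beta> * (norm ?z)\<^sup>2"
    proof -
      have "a2 * (norm ?z)\<^sup>2 = 1/2 * (lambda_min A * (norm ?z)\<^sup>2) + \<beta>/2 * (norm ?z)\<^sup>2
          - ?\<gamma> * (lambda_max A)\<^sup>2 / \<beta> * (norm ?z)\<^sup>2"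
        unfolding a2_def left_diff_distrib add_divide_distrib distrib_right by simp
      with lambda_min_le_norm_sq[OF lin_A, of ?z] show ?thesis by linarith
    qed
    moreover have "F k - F (Suc k) \<ge> \<beta>/4 * (norm (B ?l))\<^sup>2 + (1/2 * (norm (A ?z))\<^sup>2 + \<beta>/2 * (norm ?z)\<^sup>2)
        - ?\<gamma> * (lambda_max A)\<^sup>2 / \<beta> * (norm ?z)\<^sup>2"
      using L_descent[of k] S_descent[of k] Z_descent[of "Suc k"] Lambda_ascent[of "Suc k"] res
      unfolding F_eq by linarith
    ultimately have "a1 * (norm ?l)\<^sup>2 + a2 * (norm ?z)\<^sup>2 \<le> F k - F (Suc k)" by linarith
    moreover have "2 * a * (norm ?l)\<^sup>2 \<le> a1 * (norm ?l)\<^sup>2" "2 * a * (norm ?z)\<^sup>2 \<le> a2 * (norm ?z)\<^sup>2"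
      by (auto intro!: mult_right_mono simp: a_def)
    moreover have "a * (x (Suc k))\<^sup>2 \<le> a * (2 * (norm ?l)\<^sup>2 + 2 * (norm ?z)\<^sup>2)"
      using \<open>0 < a\<close> zero_le_power2[of "norm ?l - norm ?z"]
      by (intro mult_left_mono) (auto simp: x_def power2_eq_square algebra_simps)
    ultimately show ?thesis by (simp add: algebra_simps)
  qed
  ultimately show thesis by (rule that)
qed

section \<open>Boundedness of the iterates and vanishing increments\<close>

text \<open>The bound \<open>f(Z) + \<nabla>f(Z) \<bullet> r + lambda_max / 2 * \<parallel>r\<parallel>\<^sup>2 \<ge> f(Z + r) \<ge> 0\<close> absorbs the multiplier term.\<close>

lemma energy_lower_bound:
  "\<psi> (Suc k) + \<phi> (Suc k) + (\<beta> - lambda_max A) / 2 * (norm (r (Suc k)))\<^sup>2 \<le> F k"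
proof -
  let ?z = "Z (Suc k)" and ?r = "r (Suc k)"
  let ?G = "adjoint A (A ?z - D)"
  have "0 \<le> 1/2 * (norm (D - A ?z - A ?r))\<^sup>2" by simp
  also have "\<dots> = 1/2 * (norm (D - A ?z))\<^sup>2 + ?G \<bullet> ?r + 1/2 * (norm (A ?r))\<^sup>2"
    unfolding power2_norm_eq_inner
    by (simp add: adjoint_clauses[OF lin_A] inner_diff inner_add inner_commute field_simps)
  also have "\<dots> \<le> 1/2 * (norm (D - A ?z))\<^sup>2 + ?G \<bullet> ?r + 1/2 * (lambda_max A * (norm ?r)\<^sup>2)"
    by (intro add_left_mono mult_left_mono norm_sq_le_lambda_max lin_A) auto
  finally have 1: "0 \<le> 1/2 * (norm (D - A ?z))\<^sup>2 + ?G \<bullet> ?r + lambda_max A / 2 * (norm ?r)\<^sup>2" by simp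
  have 2: "\<Lambda> (Suc k) \<bullet> ?r = (1 - \<tau>) * \<beta> * (norm ?r)\<^sup>2 - ?G \<bullet> ?r"
    unfolding Lambda_eq by (simp add: inner_diff_left power2_norm_eq_inner)
  \<comment> \<open>The multiplier leaves \<open>(1 - \<tau>) * \<beta>\<close> times the squared
    residual, which the \<open>theta\<close> term of the potential compensates.\<close>
  have "(1 - \<tau>) * (\<beta> * (norm ?r)\<^sup>2) \<le> theta \<tau> * (\<beta> * (norm ?r)\<^sup>2)"
    using theta_ge beta_facts(2) by (intro mult_right_mono) auto
  then have 3: "(1 - \<tau>) * \<beta> * (norm ?r)\<^sup>2 \<le> theta \<tau> * \<beta> * (norm ?r)\<^sup>2" by (simp add: mult.assoc)
  have 4: "(\<beta> - lambda_max A) / 2 * (norm ?r)\<^sup>2 = \<beta>/2 * (norm ?r)\<^sup>2 - lambda_max A / 2 * (norm ?r)\<^sup>2"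
    by (simp add: diff_divide_distrib left_diff_distrib)
  show ?thesis
    unfolding F_eq coupling_def r_def[symmetric] 2 4 using 1 3 by linarith
qed

lemma values_le_F: "\<psi> (Suc k) + \<phi> (Suc k) \<le> F k"
proof -
  have "0 \<le> (\<beta> - lambda_max A) / 2 * (norm (r (Suc k)))\<^sup>2" using beta_facts(1) by simp
  with energy_lower_bound[of k] show ?thesis by linarith
qed

lemma F_nonneg: "0 \<le> F k"
  using values_le_F[of k] psi_nonneg[of "Suc k"] phi_nonneg[of "Suc k"] by linarith

lemma F_Suc_le: "F (Suc k) \<le> F k"
proof -
  obtain a where "0 < a" "a * (x (Suc k))\<^sup>2 \<le> F k - F (Suc k)"
    using sufficient_decrease by metis
  moreover have "0 \<le> a * (x (Suc k))\<^sup>2" using \<open>0 < a\<close> by simp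
  ultimately show ?thesis by linarith
qed

lemma F_le: "F k \<le> F 0"
  using lift_Suc_antimono_le[of F 0 k] F_Suc_le by simp

lemma x_nonneg: "0 \<le> x k" and e_nonneg: "0 \<le> e k"
  by (simp_all add: x_def e_def)

lemma abs_one_minus_tau: "\<bar>1 - \<tau>\<bar> < 1"
proof -
  have "\<tau> < 2"
  proof (rule ccontr)
    assume "\<not> \<tau> < 2"
    then have "2 * \<tau> \<le> \<tau> * \<tau>" by (intro mult_right_mono) auto
    with \<open>\<not> \<tau> < 2\<close> below_golden_ratio[OF tau] show False by (simp add: power2_eq_square)
  qed
  with tau(1) show ?thesis by auto
qed

text \<open>The decreasing potential dominates the objective values, so the starting condition
  confines \<open>L\<close> and \<open>S\<close>; the energy bound confines the residual.
  \<open>Z\<close> and \<open>\<Lambda>\<close> are continuous functions of these three, so the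
  iterates stay in the image of a compact set.\<close>

lemma bounded_iterates:
  obtains K where "compact K" "\<And>k. w k \<in> K"
proof -
  have "ereal (F 0) < Liminf (filtercomap (\<lambda>(L, S). norm L + norm S) at_top) (\<lambda>(L, S). \<Psi> L + \<Phi> S)"
    using start merit_w[of 0] unfolding potential_eq[symmetric] w_def liminf_at_infinity_def by simp
  from less_LiminfD[OF this] obtain R where
    R: "\<And>l s. R \<le> norm l + norm s \<Longrightarrow> ereal (F 0) < \<Psi> l + \<Phi> s"
    unfolding eventually_filtercomap_at_top_linorder by auto
  have LS: "norm (L (Suc k)) + norm (S (Suc k)) < R" for k
  proof (rule ccontr)
    assume "\<not> ?thesis"
    then have "ereal (F 0) < \<Psi> (L (Suc k)) + \<Phi> (S (Suc k))" by (intro R) simp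
    then have "F 0 < \<psi> (Suc k) + \<phi> (Suc k)" unfolding Psi_L Phi_S by simp
    then show False using values_le_F[of k] F_le[of k] by linarith
  qed
  define R' where "R' = sqrt (F 0 / ((\<beta> - lambda_max A) / 2))"
  have r: "norm (r (Suc k)) \<le> R'" for k
  proof -
    have "(\<beta> - lambda_max A) / 2 * (norm (r (Suc k)))\<^sup>2 \<le> F 0"
      using energy_lower_bound[of k] F_le[of k] psi_nonneg[of "Suc k"] phi_nonneg[of "Suc k"] by linarith
    then show ?thesis
      using beta_facts(1) unfolding R'_def by (intro real_le_rsqrt) (simp add: field_simps)
  qed
  define h where "h = (\<lambda>(l, s, u). (l, s, B l + C s - u,
    ((1 - \<tau>) * \<beta>) *\<^sub>R u - adjoint A (A (B l + C s - u) - D)))"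
  let ?K = "cball 0 R \<times> cball 0 R \<times> cball 0 R' :: ('a \<times> 'a \<times> 'a) set"
  have "continuous_on ?K h"
    unfolding h_def case_prod_unfold by (intro continuous_intros continuous_on_maps)
  then have "compact (h ` ?K)"
    by (intro compact_continuous_image compact_Times compact_cball)
  moreover have "w k \<in> h ` ?K" for k
  proof (rule image_eqI)
    have "norm (L (Suc k)) \<le> R" "norm (S (Suc k)) \<le> R"
      using LS[of k] norm_ge_zero[of "L (Suc k)"] norm_ge_zero[of "S (Suc k)"] by linarith+
    then show "(L (Suc k), S (Suc k), r (Suc k)) \<in> ?K" using r[of k] by simp
    show "w k = h (L (Suc k), S (Suc k), r (Suc k))"
      by (simp add: h_def w_def Lambda_eq) (simp add: r_def resid_def)
  qed
  ultimately show thesis by (rule that)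
qed

lemma F_convergent: obtains F0 where "F \<longlonglongrightarrow> F0"
proof -
  have "decseq F" using F_Suc_le by (simp add: decseq_Suc_iff)
  then show thesis
    using decseq_convergent[of F 0] F_nonneg that by blast
qed

lemma x_tendsto_0: "x \<longlonglongrightarrow> 0"
proof -
  obtain a where a: "0 < a" "\<And>k. a * (x (Suc k))\<^sup>2 \<le> F k - F (Suc k)"
    using sufficient_decrease by metis
  obtain F0 where F0: "F \<longlonglongrightarrow> F0" by (rule F_convergent)
  have "(\<lambda>k. (F k - F (Suc k)) / a) \<longlonglongrightarrow> (F0 - F0) / a"
    using a(1) by (intro tendsto_intros F0 LIMSEQ_Suc[OF F0]) auto
  then have lim: "(\<lambda>k. (F k - F (Suc k)) / a) \<longlonglongrightarrow> 0" by simp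
  have "(\<lambda>k. (x (Suc k))\<^sup>2) \<longlonglongrightarrow> 0"
    by (rule tendsto_sandwich[OF _ _ tendsto_const lim])
      (use a in \<open>auto simp: field_simps intro!: always_eventually\<close>)
  from tendsto_real_sqrt[OF this] show ?thesis
    by (simp add: x_nonneg filterlim_sequentially_Suc)
qed

lemma e_tendsto_0: "e \<longlonglongrightarrow> 0"
proof (rule contracting_recursion_tendsto_0[where \<rho> = "\<bar>1 - \<tau>\<bar>" and u = "\<lambda>k. lambda_max A / \<beta> * x (Suc k)"])
  have "(\<lambda>k. lambda_max A / \<beta> * x (Suc k)) \<longlonglongrightarrow> lambda_max A / \<beta> * 0"
    by (intro tendsto_intros LIMSEQ_Suc[OF x_tendsto_0])
  then show "(\<lambda>k. lambda_max A / \<beta> * x (Suc k)) \<longlonglongrightarrow> 0" by simp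
qed (use error in \<open>auto simp: abs_one_minus_tau e_nonneg\<close>)

section \<open>Bounds for steps and subgradients\<close>

text \<open>Both the next step and the next subgradient are linear in the current residual and the
  increments of \<open>L\<close> and \<open>Z\<close>, which bounds them without further computation.\<close>

lemma bounded_linear_resid_step: "bounded_linear (\<lambda>p. resid_step (fst p) (snd (snd p)))"
  unfolding resid_step_def
  by (intro bounded_linear_add bounded_linear_compose[OF bounded_linear_scaleR_right] bl_compose
      bounded_linear_fst bounded_linear_compose[OF bounded_linear_snd] bounded_linear_snd)

lemma x_Suc: "norm (r (Suc k)) + (norm (L (Suc (Suc k)) - L (Suc k)) + norm (Z (Suc (Suc k)) - Z (Suc k)))
    = e k + x (Suc k)"
  by (simp add: e_def x_def)

text \<open>The \<open>S\<close>-increment does not enter \<open>x\<close>: it is obtained by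
  applying a linear left inverse of \<open>C\<close> to the difference of two residuals.\<close>

lemma step_bound:
  obtains c where "0 < c" "\<And>k. dist (w (Suc k)) (w k) \<le> c * (e k + x (Suc k))"
proof -
  obtain C' where C': "linear C'" "C' \<circ> C = id"
    using linear_injective_left_inverse[OF lin_C inj_C] by blast
  define T where "T = (\<lambda>(u, a, z). (a, C' (resid_step u z - u - B a + z), z, - ((\<tau> * \<beta>) *\<^sub>R resid_step u z)))"
  have "bounded_linear T"
    unfolding T_def case_prod_unfold
    by (intro bounded_linear_Pair bounded_linear_compose[OF C'(1)[unfolded linear_conv_bounded_linear]]
        bounded_linear_add bounded_linear_sub bounded_linear_minus
        bounded_linear_compose[OF bounded_linear_scaleR_right] bl_compose bounded_linear_resid_step
        bounded_linear_fst bounded_linear_compose[OF bounded_linear_snd]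
        bounded_linear_compose[OF bounded_linear_fst] bounded_linear_snd)
  then obtain c where c: "0 < c" "\<And>u a z. norm (T (u, a, z)) \<le> c * (norm u + (norm a + norm z))"
    by (rule bounded_linear_triple_bound) blast
  have "w (Suc k) - w k = T (r (Suc k), L (Suc (Suc k)) - L (Suc k), Z (Suc (Suc k)) - Z (Suc k))" for k
  proof -
    have "C (S (Suc (Suc k)) - S (Suc k)) = r (Suc (Suc k)) - r (Suc k)
        - B (L (Suc (Suc k)) - L (Suc k)) + (Z (Suc (Suc k)) - Z (Suc k))"
      by (simp add: r_def resid_def B_simps C_simps)
    then have "C' (C (S (Suc (Suc k)) - S (Suc k))) = C' \<dots>" by simp
    then have "S (Suc (Suc k)) - S (Suc k) = C' (r (Suc (Suc k)) - r (Suc k)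
        - B (L (Suc (Suc k)) - L (Suc k)) + (Z (Suc (Suc k)) - Z (Suc k)))"
      using C'(2) by (simp add: fun_eq_iff)
    moreover have "\<Lambda> (Suc (Suc k)) - \<Lambda> (Suc k) = - ((\<tau> * \<beta>) *\<^sub>R r (Suc (Suc k)))"
      by (simp add: Lambda_Suc[of "Suc k"])
    ultimately show ?thesis
      unfolding r_Suc by (simp add: w_def T_def)
  qed
  then have "dist (w (Suc k)) (w k) \<le> c * (e k + x (Suc k))" for k
    using c(2)[of "r (Suc k)" "L (Suc (Suc k)) - L (Suc k)" "Z (Suc (Suc k)) - Z (Suc k)"]
    by (simp add: dist_norm x_Suc)
  with c(1) show thesis by (rule that)
qed

lemma coupling_has_derivative_L:
  "((\<lambda>l. coupling l s z y) has_derivative (\<lambda>h. adjoint B (\<beta> *\<^sub>R resid l s z - y) \<bullet> h)) (at l)"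
  unfolding coupling_def resid_def power2_norm_eq_inner
  by (rule derivative_eq_intros has_derivative_maps refl)+
    (auto simp: fun_eq_iff adjoint_clauses[OF lin_B] inner_diff inner_add inner_commute algebra_simps)

lemma coupling_has_derivative_S:
  "((\<lambda>s. coupling l s z y) has_derivative (\<lambda>h. adjoint C (\<beta> *\<^sub>R resid l s z - y) \<bullet> h)) (at s)"
  unfolding coupling_def resid_def power2_norm_eq_inner
  by (rule derivative_eq_intros has_derivative_maps refl)+
    (auto simp: fun_eq_iff adjoint_clauses[OF lin_C] inner_diff inner_add inner_commute algebra_simps)

text \<open>Twice the total weight \<open>\<beta>/2 + theta \<tau> * \<beta>\<close> of the squared
  residual in the potential, as it appears in gradients.\<close>

definition \<kappa> :: real where "\<kappa> = (1 + 2 * theta \<tau>) * \<beta>"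

definition smooth_grad :: "'a \<times> 'a \<times> 'a \<times> 'a \<Rightarrow> 'a \<times> 'a \<times> 'a \<times> 'a" where
  "smooth_grad = (\<lambda>(l, s, z, y). (adjoint B (\<kappa> *\<^sub>R resid l s z - y), adjoint C (\<kappa> *\<^sub>R resid l s z - y),
     adjoint A (A z - D) + y - \<kappa> *\<^sub>R resid l s z, - resid l s z))"

lemma smooth_part_has_derivative:
  "(smooth_part has_derivative (\<lambda>h. smooth_grad p \<bullet> h)) (at p)"
  unfolding smooth_part_def coupling_def resid_def power2_norm_eq_inner case_prod_unfold
  by (rule derivative_eq_intros has_derivative_maps refl)+
    (auto simp: fun_eq_iff smooth_grad_def resid_def case_prod_unfold \<kappa>_def adjoint_clauses[OF lin_A]
      adjoint_clauses[OF lin_B] adjoint_clauses[OF lin_C] inner_prod_def inner_diff inner_add inner_commute algebra_simps)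

text \<open>The subgradient of the potential at the new iterate, written in the old residual
  \<open>u\<close> and the increments \<open>a\<close> of \<open>L\<close> and \<open>z\<close> of
  \<open>Z\<close>; \<open>g_eq\<close> justifies the formula.\<close>

definition grad_map :: "'a \<times> 'a \<times> 'a \<Rightarrow> 'a \<times> 'a \<times> 'a \<times> 'a" where
  "grad_map = (\<lambda>(u, a, z).
     (adjoint B ((\<tau> * \<beta> + \<kappa>) *\<^sub>R resid_step u z - \<beta> *\<^sub>R u - \<beta> *\<^sub>R B a),
      adjoint C ((\<tau> * \<beta> + \<kappa> - \<beta>) *\<^sub>R resid_step u z - \<beta> *\<^sub>R z),
      (\<beta> - \<tau> * \<beta> - \<kappa>) *\<^sub>R resid_step u z, - resid_step u z))"

definition g :: "nat \<Rightarrow> 'a \<times> 'a \<times> 'a \<times> 'a" where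
  "g k = grad_map (r k, L (Suc k) - L k, Z (Suc k) - Z k)"

lemma g_bound:
  obtains b where "0 < b" "\<And>k. norm (g (Suc k)) \<le> b * (e k + x (Suc k))"
proof -
  have "bounded_linear grad_map"
    unfolding grad_map_def case_prod_unfold
    by (intro bounded_linear_Pair
        bounded_linear_add bounded_linear_sub bounded_linear_minus
        bounded_linear_compose[OF bounded_linear_scaleR_right] bl_compose bounded_linear_resid_step
        bounded_linear_fst bounded_linear_compose[OF bounded_linear_snd]
        bounded_linear_compose[OF bounded_linear_fst] bounded_linear_snd)
  then obtain b where "0 < b" "\<And>u a z. norm (grad_map (u, a, z)) \<le> b * (norm u + (norm a + norm z))"
    by (rule bounded_linear_triple_bound) blast
  then show thesis
    using that by (metis g_def x_Suc)
qed

text \<open>By Fermat's rule this is a subgradient of \<open>\<Psi>\<close> at the new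
  \<open>L\<close>, taken with the old values of the other blocks.\<close>

definition gL :: "nat \<Rightarrow> 'a" where
  "gL k = - adjoint B (\<beta> *\<^sub>R resid (L (Suc k)) (S k) (Z k) - \<Lambda> k)"

definition gS :: "nat \<Rightarrow> 'a" where
  "gS k = - adjoint C (\<beta> *\<^sub>R resid (L (Suc k)) (S (Suc k)) (Z k) - \<Lambda> k)"

lemma gL_minorant: "frechet_minorant \<Psi> (L (Suc (Suc k))) (gL (Suc k))"
  unfolding gL_def
  by (rule minimizer_imp_frechet_minorant[OF L_opt coupling_has_derivative_L])
    (use finite_values[of "Suc k"] in simp)

lemma gS_minorant: "frechet_minorant \<Phi> (S (Suc (Suc k))) (gS (Suc k))"
  unfolding gS_def
  by (rule minimizer_imp_frechet_minorant[OF S_opt coupling_has_derivative_S])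
    (use finite_values[of "Suc k"] in simp)

text \<open>The subproblem gradients use old blocks and the potential gradient new ones. The
  mismatch consists of increments and residuals; in the \<open>Z\<close> block the data term is
  eliminated by \<open>Z_opt\<close>.\<close>

lemma g_eq: "g (Suc k) = (gL (Suc k), gS (Suc k), 0) + smooth_grad (w (Suc k))"
proof -
  let ?l = "L (Suc (Suc k))" and ?s = "S (Suc (Suc k))" and ?z = "Z (Suc (Suc k))"
    and ?r = "r (Suc (Suc k))"
  have rs: "resid_step (r (Suc k)) (?z - Z (Suc k)) = ?r" by (simp only: r_Suc)
  have resL: "resid ?l (S (Suc k)) (Z (Suc k)) = r (Suc k) + B (?l - L (Suc k))"
    by (simp add: r_def resid_def B_simps)
  have resS: "resid ?l ?s (Z (Suc k)) = ?r + (?z - Z (Suc k))"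
    by (simp add: r_def resid_def)
  have L1: "\<Lambda> (Suc (Suc k)) = \<Lambda> (Suc k) - (\<tau> * \<beta>) *\<^sub>R ?r" by (rule Lambda_Suc)
  have G: "adjoint A (A ?z - D) = \<beta> *\<^sub>R ?r - \<Lambda> (Suc k)"
    using Z_opt[of "Suc k"] by (simp add: algebra_simps)
  have "gL (Suc k) + adjoint B (\<kappa> *\<^sub>R ?r - \<Lambda> (Suc (Suc k)))
      = adjoint B ((\<tau> * \<beta> + \<kappa>) *\<^sub>R ?r - \<beta> *\<^sub>R r (Suc k) - \<beta> *\<^sub>R B (?l - L (Suc k)))"
    unfolding gL_def resL L1 by (simp add: B'_simps algebra_simps)
  moreover have "gS (Suc k) + adjoint C (\<kappa> *\<^sub>R ?r - \<Lambda> (Suc (Suc k)))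
      = adjoint C ((\<tau> * \<beta> + \<kappa> - \<beta>) *\<^sub>R ?r - \<beta> *\<^sub>R (?z - Z (Suc k)))"
    unfolding gS_def resS L1 by (simp add: C'_simps algebra_simps)
  moreover have "adjoint A (A ?z - D) + \<Lambda> (Suc (Suc k)) - \<kappa> *\<^sub>R ?r = (\<beta> - \<tau> * \<beta> - \<kappa>) *\<^sub>R ?r"
    unfolding G L1 by (simp add: algebra_simps)
  ultimately show ?thesis
    by (simp add: g_def grad_map_def rs smooth_grad_def w_def zero_prod_def flip: r_def)
qed

lemma g_subgradient: "g (Suc k) \<in> frechet_subdiff merit (w (Suc k))"
proof (rule frechet_minorant_imp_subdiff)
  show "\<bar>merit (w (Suc k))\<bar> \<noteq> \<infinity>" by (simp add: merit_w)
  \<comment> \<open>The pair of \<open>Z\<close> and \<open>\<Lambda>\<close> is kept together as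
    the third block, on which only the smooth part depends.\<close>
  have "frechet_minorant (\<lambda>(l, s, p). \<Psi> l + \<Phi> s + ereal (smooth_part (l, s, p)))
      (L (Suc (Suc k)), S (Suc (Suc k)), Z (Suc (Suc k)), \<Lambda> (Suc (Suc k)))
      ((gL (Suc k), gS (Suc k), 0) + smooth_grad (w (Suc k)))"
    using finite_values[of "Suc k"]
    by (intro frechet_minorant_separable_sum gL_minorant gS_minorant)
      (auto simp: w_def intro: smooth_part_has_derivative)
  moreover have "(\<lambda>(l, s, p). \<Psi> l + \<Phi> s + ereal (smooth_part (l, s, p))) = merit"
    by (auto simp: merit_def fun_eq_iff)
  ultimately show "frechet_minorant merit (w (Suc k)) (g (Suc k))"
    unfolding g_eq by (simp add: w_def)
qed

lemma Psi_finite: "\<Psi> l \<le> ereal c \<Longrightarrow> \<bar>\<Psi> l\<bar> \<noteq> \<infinity>" and Phi_finite: "\<Phi> s \<le> ereal c \<Longrightarrow> \<bar>\<Phi> s\<bar> \<noteq> \<infinity>"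
  using Psi_nonneg[of l] Phi_nonneg[of s] by (cases "\<Psi> l"; cases "\<Phi> s"; simp)+

section \<open>Properties of cluster points\<close>

context
  fixes s :: "nat \<Rightarrow> nat" and L' S' Z' \<Lambda>' :: 'a
  assumes s: "strict_mono s" and ws: "(\<lambda>j. w (s j)) \<longlonglongrightarrow> (L', S', Z', \<Lambda>')"
begin

lemma step_null: "(\<lambda>j. e (s j) + x (Suc (s j))) \<longlonglongrightarrow> 0"
proof -
  have "(\<lambda>k. e k + x (Suc k)) \<longlonglongrightarrow> 0 + 0"
    by (intro tendsto_add e_tendsto_0 LIMSEQ_Suc[OF x_tendsto_0])
  from LIMSEQ_subseq_LIMSEQ[OF this s] show ?thesis by (simp add: o_def)
qed

text \<open>Optimality conditions mix components of consecutive iterates, so both shifts of the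
  subsequence must share the limit; this holds because steps vanish.\<close>

lemma w_Suc_tendsto: "(\<lambda>j. w (Suc (s j))) \<longlonglongrightarrow> (L', S', Z', \<Lambda>')"
proof -
  obtain c where c: "0 < c" "\<And>k. dist (w (Suc k)) (w k) \<le> c * (e k + x (Suc k))"
    using step_bound by blast
  have "(\<lambda>j. c * (e (s j) + x (Suc (s j)))) \<longlonglongrightarrow> 0"
    by (rule tendsto_mult_right_zero[OF step_null])
  then have "(\<lambda>j. w (Suc (s j)) - w (s j)) \<longlonglongrightarrow> 0"
    by (rule Lim_null_comparison[rotated]) (use c(2) in \<open>auto simp: dist_norm\<close>)
  from tendsto_add[OF this ws] show ?thesis by simp
qed

lemma cluster_components:
  "(\<lambda>j. L (Suc (s j))) \<longlonglongrightarrow> L'" "(\<lambda>j. L (Suc (Suc (s j)))) \<longlonglongrightarrow> L'"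
  "(\<lambda>j. S (Suc (s j))) \<longlonglongrightarrow> S'" "(\<lambda>j. S (Suc (Suc (s j)))) \<longlonglongrightarrow> S'"
  "(\<lambda>j. Z (Suc (s j))) \<longlonglongrightarrow> Z'" "(\<lambda>j. \<Lambda> (Suc (s j))) \<longlonglongrightarrow> \<Lambda>'"
  using tendsto_fst[OF ws] tendsto_snd[OF ws] tendsto_fst[OF w_Suc_tendsto] tendsto_snd[OF w_Suc_tendsto]
    tendsto_fst[OF tendsto_snd[OF ws]] tendsto_fst[OF tendsto_snd[OF w_Suc_tendsto]]
    tendsto_fst[OF tendsto_snd[OF tendsto_snd[OF ws]]] tendsto_snd[OF tendsto_snd[OF tendsto_snd[OF ws]]]
  by (simp_all add: w_def)

lemma cluster_values_finite: "\<bar>\<Psi> L'\<bar> \<noteq> \<infinity>" "\<bar>\<Phi> S'\<bar> \<noteq> \<infinity>"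
proof -
  have "\<psi> (Suc k) \<le> F 0" "\<phi> (Suc k) \<le> F 0" for k
    using values_le_F[of k] F_le[of k] psi_nonneg[of "Suc k"] phi_nonneg[of "Suc k"] by linarith+
  then have "\<Psi> L' \<le> ereal (F 0)" "\<Phi> S' \<le> ereal (F 0)"
    by (auto intro!: always_eventually lsc_limit_le[OF lsc_Psi cluster_components(1)] lsc_limit_le[OF lsc_Phi cluster_components(3)]
        simp: Psi_L Phi_S)
  then show "\<bar>\<Psi> L'\<bar> \<noteq> \<infinity>" "\<bar>\<Phi> S'\<bar> \<noteq> \<infinity>"
    by (auto dest: Psi_finite Phi_finite)
qed

text \<open>Using the limit \<open>L'\<close> as competitor in the \<open>L\<close>-step bounds the
  values from above up to a coupling difference that vanishes.\<close>

lemma Psi_tendsto: "(\<lambda>j. \<Psi> (L (Suc (Suc (s j))))) \<longlonglongrightarrow> \<Psi> L'"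
proof (rule lsc_tendsto_of_upper_bound[OF lsc_Psi cluster_components(2)])
  let ?d = "\<lambda>j. coupling L' (S (Suc (s j))) (Z (Suc (s j))) (\<Lambda> (Suc (s j)))
      - coupling (L (Suc (Suc (s j)))) (S (Suc (s j))) (Z (Suc (s j))) (\<Lambda> (Suc (s j)))"
  show "\<Psi> (L (Suc (Suc (s j)))) \<le> \<Psi> L' + ereal (?d j)" for j
    using L_opt[of "s j" L'] cluster_values_finite unfolding Psi_L by (cases "\<Psi> L'") auto
  have "?d \<longlonglongrightarrow> coupling L' S' Z' \<Lambda>' - coupling L' S' Z' \<Lambda>'"
    unfolding coupling_def resid_def by (intro tendsto_intros tendsto_maps cluster_components)
  then show "?d \<longlonglongrightarrow> 0" by simp
qed

lemma Phi_tendsto: "(\<lambda>j. \<Phi> (S (Suc (Suc (s j))))) \<longlonglongrightarrow> \<Phi> S'"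
proof (rule lsc_tendsto_of_upper_bound[OF lsc_Phi cluster_components(4)])
  let ?d = "\<lambda>j. coupling (L (Suc (Suc (s j)))) S' (Z (Suc (s j))) (\<Lambda> (Suc (s j)))
      - coupling (L (Suc (Suc (s j)))) (S (Suc (Suc (s j)))) (Z (Suc (s j))) (\<Lambda> (Suc (s j)))"
  show "\<Phi> (S (Suc (Suc (s j)))) \<le> \<Phi> S' + ereal (?d j)" for j
    using S_opt[of "s j" S'] cluster_values_finite unfolding Phi_S by (cases "\<Phi> S'") auto
  have "?d \<longlonglongrightarrow> coupling L' S' Z' \<Lambda>' - coupling L' S' Z' \<Lambda>'"
    unfolding coupling_def resid_def by (intro tendsto_intros tendsto_maps cluster_components)
  then show "?d \<longlonglongrightarrow> 0" by simp
qed

lemma merit_tendsto: "(\<lambda>j. merit (w (Suc (s j)))) \<longlonglongrightarrow> merit (L', S', Z', \<Lambda>')"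
proof -
  have "isCont smooth_part (L', S', Z', \<Lambda>')"
    using smooth_part_has_derivative by (rule has_derivative_continuous)
  then have "(\<lambda>j. smooth_part (w (Suc (s j)))) \<longlonglongrightarrow> smooth_part (L', S', Z', \<Lambda>')"
    using w_Suc_tendsto by (rule isCont_tendsto_compose)
  then have "(\<lambda>j. \<Psi> (L (Suc (Suc (s j)))) + \<Phi> (S (Suc (Suc (s j)))) + ereal (smooth_part (w (Suc (s j)))))
      \<longlonglongrightarrow> \<Psi> L' + \<Phi> S' + ereal (smooth_part (L', S', Z', \<Lambda>'))"
    using cluster_values_finite
    by (intro tendsto_add_ereal_general Psi_tendsto Phi_tendsto tendsto_ereal) auto
  then show ?thesis by (simp add: merit_def w_def)
qed

text \<open>Identifies the limit of the potential values with the value at the cluster point, as the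
  KL argument requires.\<close>

lemma cluster_energy: "F \<longlonglongrightarrow> F0 \<Longrightarrow> merit (L', S', Z', \<Lambda>') = ereal F0"
proof -
  assume "F \<longlonglongrightarrow> F0"
  from LIMSEQ_subseq_LIMSEQ[OF LIMSEQ_Suc[OF this] s]
  have "(\<lambda>j. merit (w (Suc (s j)))) \<longlonglongrightarrow> ereal F0"
    unfolding merit_w by (intro tendsto_ereal) (simp add: o_def)
  with merit_tendsto show ?thesis by (rule LIMSEQ_unique)
qed

text \<open>A KL function has the KL property only on \<open>dom_subdiff\<close>; the vanishing
  subgradients \<open>g\<close> put the cluster point there.\<close>

lemma cluster_critical: "0 \<in> subdiff merit (L', S', Z', \<Lambda>')"
proof -
  obtain b where b: "0 < b" "\<And>k. norm (g (Suc k)) \<le> b * (e k + x (Suc k))"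
    using g_bound by blast
  have "(\<lambda>j. b * (e (s j) + x (Suc (s j)))) \<longlonglongrightarrow> 0"
    by (rule tendsto_mult_right_zero[OF step_null])
  then have "(\<lambda>j. g (Suc (s j))) \<longlonglongrightarrow> 0"
    by (rule Lim_null_comparison[rotated]) (use b(2) in auto)
  moreover have "(L', S', Z', \<Lambda>') \<in> edom merit"
    using cluster_values_finite by (auto simp: edom_def merit_def)
  ultimately show ?thesis
    using w_Suc_tendsto merit_tendsto g_subgradient unfolding subdiff_def by blast
qed

lemma cluster_feasible: "Z' = B L' + C S'"
proof -
  have "(\<lambda>j. r (Suc (s j))) \<longlonglongrightarrow> B L' + C S' - Z'"
    unfolding r_def resid_def by (intro tendsto_intros tendsto_maps cluster_components)
  moreover have "(\<lambda>j. r (Suc (s j))) \<longlonglongrightarrow> 0"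
    using LIMSEQ_subseq_LIMSEQ[OF e_tendsto_0 s]
    by (simp add: e_def o_def tendsto_norm_zero_iff)
  ultimately have "B L' + C S' - Z' = 0" by (rule LIMSEQ_unique)
  then show ?thesis by simp
qed

lemma cluster_dual: "\<Lambda>' = - adjoint A (A (B L' + C S') - D)"
proof -
  have "(\<lambda>j. \<Lambda> (Suc (s j))) \<longlonglongrightarrow> ((1 - \<tau>) * \<beta>) *\<^sub>R (B L' + C S' - Z') - adjoint A (A Z' - D)"
    unfolding Lambda_eq r_def resid_def by (intro tendsto_intros tendsto_maps cluster_components)
  with cluster_components(6) have "\<Lambda>' = ((1 - \<tau>) * \<beta>) *\<^sub>R (B L' + C S' - Z') - adjoint A (A Z' - D)"
    by (rule LIMSEQ_unique)
  then show ?thesis by (simp add: cluster_feasible)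
qed

lemma cluster_stationary: "stationary_point \<Psi> \<Phi> D A B C L' S'"
proof -
  \<comment> \<open>At the limit the residual vanishes, so the subgradients tend to the adjoints
    applied to \<open>\<Lambda>'\<close>, and \<open>cluster_dual\<close> rewrites these as the
    gradient terms of stationarity.\<close>
  have "(\<lambda>j. gL (Suc (s j))) \<longlonglongrightarrow> - adjoint B (\<beta> *\<^sub>R (B L' + C S' - Z') - \<Lambda>')"
    unfolding gL_def resid_def by (intro tendsto_intros tendsto_maps cluster_components)
  then have "(\<lambda>j. gL (Suc (s j))) \<longlonglongrightarrow> adjoint B \<Lambda>'"
    by (simp add: cluster_feasible B'_simps)
  moreover have "gL (Suc (s j)) \<in> frechet_subdiff \<Psi> (L (Suc (Suc (s j))))" for j
    using gL_minorant finite_values[of "Suc (s j)"] by (intro frechet_minorant_imp_subdiff) auto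
  moreover have "L' \<in> edom \<Psi>" "S' \<in> edom \<Phi>" using cluster_values_finite by (auto simp: edom_def)
  ultimately have "adjoint B \<Lambda>' \<in> subdiff \<Psi> L'"
    using cluster_components(2) Psi_tendsto unfolding subdiff_def by blast
  moreover have "(\<lambda>j. gS (Suc (s j))) \<longlonglongrightarrow> - adjoint C (\<beta> *\<^sub>R (B L' + C S' - Z') - \<Lambda>')"
    unfolding gS_def resid_def by (intro tendsto_intros tendsto_maps cluster_components)
  then have "(\<lambda>j. gS (Suc (s j))) \<longlonglongrightarrow> adjoint C \<Lambda>'"
    by (simp add: cluster_feasible C'_simps)
  moreover have "gS (Suc (s j)) \<in> frechet_subdiff \<Phi> (S (Suc (Suc (s j))))" for j
    using gS_minorant finite_values[of "Suc (s j)"] by (intro frechet_minorant_imp_subdiff) auto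
  ultimately have "adjoint B \<Lambda>' \<in> subdiff \<Psi> L'" "adjoint C \<Lambda>' \<in> subdiff \<Phi> S'"
    using cluster_components(4) Phi_tendsto \<open>S' \<in> edom \<Phi>\<close> unfolding subdiff_def by blast+
  then show ?thesis
    unfolding stationary_point_def
    by (auto simp: cluster_dual B'_simps C'_simps intro!: rev_image_eqI)
qed

end

section \<open>Convergence of the whole sequence\<close>

theorem converges_to_stationary_point:
  assumes KL: "KL_function merit"
  obtains L' S' Z' \<Lambda>' where "w \<longlonglongrightarrow> (L', S', Z', \<Lambda>')" "stationary_point \<Psi> \<Phi> D A B C L' S'"
proof -
  obtain K where "compact K" "\<And>k. w k \<in> K" using bounded_iterates by blast
  then obtain w' s where s: "strict_mono s" "(w \<circ> s) \<longlonglongrightarrow> w'"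
    unfolding compact_def by blast
  obtain L' S' Z' \<Lambda>' where w': "w' = (L', S', Z', \<Lambda>')" by (cases w')
  have ws: "(\<lambda>j. w (s j)) \<longlonglongrightarrow> (L', S', Z', \<Lambda>')" using s(2) by (simp add: w' o_def)
  obtain F0 where F0: "F \<longlonglongrightarrow> F0" by (rule F_convergent)
  obtain a where a: "0 < a" "\<And>k. a * (x (Suc k))\<^sup>2 \<le> F k - F (Suc k)"
    using sufficient_decrease by blast
  obtain b where b: "0 < b" "\<And>k. norm (g (Suc k)) \<le> b * (e k + x (Suc k))"
    using g_bound by blast
  obtain c where c: "0 < c" "\<And>k. dist (w (Suc k)) (w k) \<le> c * (e k + x (Suc k))"
    using step_bound by blast
  have KL': "KL_property merit (L', S', Z', \<Lambda>')"
    using KL cluster_critical[OF s(1) ws] unfolding KL_function_def dom_subdiff_def by blast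
  have "w \<longlonglongrightarrow> (L', S', Z', \<Lambda>')"
  proof (rule KL_descent_converges[OF merit_w x_nonneg e_nonneg a(1) less_imp_le[OF b(1)] _ c(1)
        abs_ge_zero abs_one_minus_tau a(2) error _ b(2) c(2) s(1) ws F0 cluster_energy[OF s(1) ws F0]
        x_tendsto_0 e_tendsto_0 KL'])
    show "0 \<le> lambda_max A / \<beta>" using lambda_max_nonneg[OF lin_A] beta_facts(2) by simp
    show "g (Suc k) \<in> subdiff merit (w (Suc k))" for k
      using g_subgradient frechet_subdiff_subset_subdiff by blast
  qed
  then show thesis
    using cluster_stationary[OF s(1) ws] by (rule that)
qed

end

theorem theorem4p4:
  fixes \<Psi> \<Phi> :: "real^'n^'m \<Rightarrow> ereal"
    and D :: "real^'n^'m"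
    and A B C :: "real^'n^'m \<Rightarrow> real^'n^'m"
    and \<tau> \<beta> :: real
    and L S Z \<Lambda> :: "nat \<Rightarrow> real^'n^'m"
  assumes "proper \<Psi>" and "lsc \<Psi>" and "\<forall>X. 0 \<le> \<Psi> X" and "econvex \<Psi>"
    and "proper \<Phi>" and "lsc \<Phi>" and "\<forall>X. 0 \<le> \<Phi> X"
    and "linear A" and "linear B" and "linear C" and "inj B" and "inj C"
    and "0 < \<tau>" and "\<tau> < (1 + sqrt 5) / 2"
    and "\<beta> > beta_bar A \<tau>"
    and "ADMM_sequence \<Psi> \<Phi> D A B C \<tau> \<beta> L S Z \<Lambda>"
    and "\<exists>\<sigma>>0. loewner_ge (adjoint B \<circ> B) (\<lambda>X. \<sigma> *\<^sub>R X)"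
    and "\<exists>\<sigma>'>0. loewner_ge (adjoint C \<circ> C) (\<lambda>X. \<sigma>' *\<^sub>R X)"
    and "continuous_on (edom \<Psi>) \<Psi>"
    and "potential \<Psi> \<Phi> D A B C \<tau> \<beta> (L 1) (S 1) (Z 1) (\<Lambda> 1) < liminf_at_infinity \<Psi> \<Phi>"
    and "KL_function (\<lambda>(L, S, Z, \<Lambda>). potential \<Psi> \<Phi> D A B C \<tau> \<beta> L S Z \<Lambda>)"
  shows "\<exists>L' S' Z' \<Lambda>'.
           (\<lambda>k. (L k, S k, Z k, \<Lambda> k)) \<longlonglongrightarrow> (L', S', Z', \<Lambda>') \<and>
           stationary_point \<Psi> \<Phi> D A B C L' S'"
proof -
  obtain \<sigma> where \<sigma>: "0 < \<sigma>" "loewner_ge (adjoint B \<circ> B) (\<lambda>X. \<sigma> *\<^sub>R X)"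
    using assms(17) by blast
  interpret admm \<Psi> \<Phi> D A B C \<tau> \<beta> \<sigma> L S Z \<Lambda>
    by (intro admm.intro) (fact \<sigma> assms assms(3)[rule_format] assms(7)[rule_format])+
  obtain L' S' Z' \<Lambda>' where lim: "w \<longlonglongrightarrow> (L', S', Z', \<Lambda>')" and "stationary_point \<Psi> \<Phi> D A B C L' S'"
    by (rule converges_to_stationary_point[OF assms(21)[unfolded potential_eq]])
  moreover have "(\<lambda>k. (L k, S k, Z k, \<Lambda> k)) \<longlonglongrightarrow> (L', S', Z', \<Lambda>')"
    \<comment> \<open>\<open>w\<close> is the sequence of iterates without its initial term, so the
      limit transfers back.\<close>
    by (rule LIMSEQ_imp_Suc) (use lim in \<open>simp add: w_def[abs_def]\<close>)
  ultimately show ?thesis by blast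
qed

end
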